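(* Let $\pi\in\mathcal{A}$ and let $(\tilde{P},P,L)$ be the image of $\pi$ under the $spo$-correspondence. Then $\tilde{P}$ is an $spo(2m,n)$-tableau of some shape $\lambda$, $P$ is a semistandard tableau of the same shape $\lambda$ with entries in $\{1,\dots,q\}$, and $L$ is a Burge two-line array.
   Context: Fix positive integers $m,n,q$. Let $B_0=\{1,\overline{1},\dots,m,\overline{m}\}$ and $B_1=\{1^\circ,\dots,n^\circ\}$, totally ordered by $1<\overline{1}<2<\overline{2}<\cdots<m<\overline{m}<1^\circ<\cdots<n^\circ$. Young diagrams are drawn with row $1$ on top. A tableau is semistandard if rows weakly increase left to right and columns strictly increase top to bottom. An $spo(2m,n)$-tableau of shape $\lambda$ is a filling of the Young diagram of $\lambda$ with entries of $B_0\cup B_1$ such that the boxes with entries in $B_0$ form a Young diagram of a shape $\mu\subseteq\lambda$ on which entries weakly increase along rows, strictly increase down columns, and every entry in row $i$ is $\geq i$ (no $j$ or $\overline{j}$ with $j<i$ in row $i$); and the entries of $B_1$ in $\lambda/\mu$ strictly increase along rows and weakly increase down columns. Forward slide: for a filling with one empty box, with $x$ the entry immediately to its right and $y$ the entry immediately below; if only one exists it moves in; otherwise $x$ moves left if $x<y$ or $x=y\in B_1$, and $y$ moves up if $y<x$ or $x=y\in B_0$. Repeat until the empty box is at an outer corner, and delete that box. $spo$-insertion $T\leftarrow x$: insert $z=x$ into row 1; to insert $z$ into row $r$: if $z\in B_0$ and $z\geq$ all entries of row $r$, or $z\in B_1$ and $z>$ all entries of row $r$ (including an empty row below the tableau),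 append $z$ at the end of row $r$ and stop; otherwise let $z'$ be the leftmost entry of row $r$ with $z'\geq z$ (if $z\in B_1$) or with $z'>z$ (if $z\in B_0$), replace $z'$ by $z$ and insert $z'$ into row $r+1$. If at some stage an $i\in\{1,\dots,m\}$ inserted into row $i$ would bump an $\overline{i}$ out of row $i$ (a cancellation), then at the first such stage the $\overline{i}$ is removed instead (and $i$ not placed) and forward slides move the empty box to an outer corner, where it is deleted. Thus $T\leftarrow x$ has one box more or one box fewer than $T$. $\mathcal{A}$ is the set of two-line arrays $\pi=\begin{pmatrix}a_1&\cdots&a_s\\ b_1&\cdots&b_s\end{pmatrix}$ with $a_i\in\{1,\dots,q\}$, $b_i\in B_0\cup B_1$, such that $a_i\leq a_{i+1}$, and $a_i=a_{i+1}$ implies $b_i\leq b_{i+1}$, and each column $\binom{i}{j}$ with $j\in B_1$ occurs at most once. A Burge two-line array is an array $\begin{pmatrix}i_1&\cdots&i_r\\ j_1&\cdots&j_r\end{pmatrix}$ with $i_k\in\{1,\dots,q\}$, $j_k\in\{1,\dots,q-1\}$, $i_k\leq i_{k+1}$, $i_k=i_{k+1}\Rightarrow j_k\leq j_{k+1}$, and $i_k>j_k$ for all $k$. The $spo$-correspondence: set $\tilde{P}_0=P_0=L_0=\emptyset$. For $k=1,\dots,s$, with $k$-th column $\binom{i}{j}$ of $\pi$, let $\tilde{P}_k=\tilde{P}_{k-1}\leftarrow j$. If a box was added, form $P_k$ by adding a box containing $i$ to $P_{k-1}$ in the same position as the new box of $\tilde{P}_k$, and set $L_k=L_{k-1}$.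 If a box was removed, consider the box of $P_{k-1}$ in the position of the box of $\tilde{P}_{k-1}$ missing from $\tilde{P}_k$ (an outer corner) and perform reverse RSK column insertion starting from the entry in that box (the box is removed, and its entry, when moved into column $c-1$, replaces the largest entry of column $c-1$ strictly smaller than it, which is then moved into column $c-2$, and so on), until an entry $a$ is bumped out of the first column; let $P_k$ be the result and let $L_k$ be $L_{k-1}$ with the column $\binom{i}{a}$ appended on the right. The image of $\pi$ is $(\tilde{P},P,L)=(\tilde{P}_s,P_s,L_s)$.
   Formalization: In reverse RSK column insertion, an entry moved into column c-1 replaces the largest entry of that column less than or equal to it, not strictly smaller; the strict rule is undefined, e.g., for columns (1, 1̄), (1, 1̄), (2, 1) with m=1, q=2. *)

theory Defs
  imports Main
begin

text \<open>
  The letters \<open>i\<close>, \<open>i\<close> barred and \<open>i\<close> circled.  The alphabets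
  \<open>B0 m\<close> and \<open>B1 n\<close> restrict the indices to \<open>{1..m}\<close> and \<open>{1..n}\<close>.
\<close>

datatype letter = Plain nat | Barred nat | Circled nat

fun letter_key :: "letter \<Rightarrow> nat \<times> nat" where
  "letter_key (Plain i) = (0, 2 * i)"
| "letter_key (Barred i) = (0, 2 * i + 1)"
| "letter_key (Circled i) = (1, i)"

lemma letter_key_inj: "letter_key x = letter_key y \<Longrightarrow> x = y"
  by (cases x; cases y) (auto, presburger+)

instantiation letter :: linorder
begin

definition less_eq_letter :: "letter \<Rightarrow> letter \<Rightarrow> bool" where
  "x \<le> y \<longleftrightarrow> fst (letter_key x) < fst (letter_key y) \<or>
     fst (letter_key x) = fst (letter_key y) \<and> snd (letter_key x) \<le> snd (letter_key y)"

definition less_letter :: "letter \<Rightarrow> letter \<Rightarrow> bool" where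
  "x < y \<longleftrightarrow> x \<le> y \<and> \<not> y \<le> (x :: letter)"

instance
proof
  fix x y z :: letter
  show "x < y \<longleftrightarrow> x \<le> y \<and> \<not> y \<le> x" by (rule less_letter_def)
  show "x \<le> x" by (simp add: less_eq_letter_def)
  show "x \<le> y \<Longrightarrow> y \<le> z \<Longrightarrow> x \<le> z" by (auto simp: less_eq_letter_def)
  show "x \<le> y \<Longrightarrow> y \<le> x \<Longrightarrow> x = y"
    by (rule letter_key_inj) (auto simp: less_eq_letter_def prod_eq_iff)
  show "x \<le> y \<or> y \<le> x" by (auto simp: less_eq_letter_def)
qed

end

definition B0 :: "nat \<Rightarrow> letter set" where
  "B0 m = Plain ` {1..m} \<union> Barred ` {1..m}"

definition B1 :: "nat \<Rightarrow> letter set" where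
  "B1 n = Circled ` {1..n}"

fun in_B0 :: "letter \<Rightarrow> bool" where
  "in_B0 (Plain _) = True"
| "in_B0 (Barred _) = True"
| "in_B0 (Circled _) = False"


text \<open>
  A tableau is the list of its rows, top row first.  Rows and columns are numbered
  from \<open>0\<close>, so that the box \<open>(r, c)\<close> lies in row \<open>Suc r\<close> and column \<open>Suc c\<close> in
  the usual numbering; its entry is \<open>T ! r ! c\<close>.
\<close>

type_synonym 'a tableau = "'a list list"

definition partition_shape :: "nat list \<Rightarrow> bool" where
  "partition_shape lam \<longleftrightarrow> sorted_wrt (\<ge>) lam \<and> 0 \<notin> set lam"

definition diagram :: "nat list \<Rightarrow> (nat \<times> nat) set" where
  "diagram lam = {(r, c). r < length lam \<and> c < lam ! r}"

definition shape :: "'a tableau \<Rightarrow> nat list" where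
  "shape T = map length T"

definition rows_weak :: "(nat \<times> nat) set \<Rightarrow> 'a::linorder tableau \<Rightarrow> bool" where
  "rows_weak D T \<longleftrightarrow>
     (\<forall>r c c'. (r, c) \<in> D \<and> (r, c') \<in> D \<and> c < c' \<longrightarrow> T ! r ! c \<le> T ! r ! c')"

definition rows_strict :: "(nat \<times> nat) set \<Rightarrow> 'a::linorder tableau \<Rightarrow> bool" where
  "rows_strict D T \<longleftrightarrow>
     (\<forall>r c c'. (r, c) \<in> D \<and> (r, c') \<in> D \<and> c < c' \<longrightarrow> T ! r ! c < T ! r ! c')"

definition cols_weak :: "(nat \<times> nat) set \<Rightarrow> 'a::linorder tableau \<Rightarrow> bool" where
  "cols_weak D T \<longleftrightarrow>
     (\<forall>r r' c. (r, c) \<in> D \<and> (r', c) \<in> D \<and> r < r' \<longrightarrow> T ! r ! c \<le> T ! r' ! c)"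

definition cols_strict :: "(nat \<times> nat) set \<Rightarrow> 'a::linorder tableau \<Rightarrow> bool" where
  "cols_strict D T \<longleftrightarrow>
     (\<forall>r r' c. (r, c) \<in> D \<and> (r', c) \<in> D \<and> r < r' \<longrightarrow> T ! r ! c < T ! r' ! c)"

definition semistandard :: "nat list \<Rightarrow> 'a::linorder tableau \<Rightarrow> bool" where
  "semistandard lam T \<longleftrightarrow> partition_shape lam \<and> shape T = lam \<and>
     rows_weak (diagram lam) T \<and> cols_strict (diagram lam) T"

definition entries :: "'a tableau \<Rightarrow> 'a set" where
  "entries T = \<Union> (set ` set T)"

definition spo_tableau :: "nat \<Rightarrow> nat \<Rightarrow> nat list \<Rightarrow> letter tableau \<Rightarrow> bool" where
  "spo_tableau m n lam T \<longleftrightarrow>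
     partition_shape lam \<and> shape T = lam \<and> entries T \<subseteq> B0 m \<union> B1 n \<and>
     (\<exists>mu. partition_shape mu \<and>
        {(r, c) \<in> diagram lam. T ! r ! c \<in> B0 m} = diagram mu \<and>
        rows_weak (diagram mu) T \<and> cols_strict (diagram mu) T \<and>
        (\<forall>(r, c) \<in> diagram mu. Plain (Suc r) \<le> T ! r ! c) \<and>
        rows_strict (diagram lam - diagram mu) T \<and>
        cols_weak (diagram lam - diagram mu) T)"

definition put :: "'a tableau \<Rightarrow> nat \<Rightarrow> nat \<Rightarrow> 'a \<Rightarrow> 'a tableau" where
  "put T r c x = T[r := (T ! r)[c := x]]"

text \<open>
  Boxes are only added and removed at the end of a row.  Row \<open>length T\<close> stands for the
  empty row below \<open>T\<close>, and a row that becomes empty disappears.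
\<close>

definition add_box :: "'a tableau \<Rightarrow> nat \<Rightarrow> 'a \<Rightarrow> 'a tableau" where
  "add_box T r x = (if r = length T then T @ [[x]] else T[r := T ! r @ [x]])"

definition delete_box :: "'a tableau \<Rightarrow> nat \<Rightarrow> 'a tableau" where
  "delete_box T r = filter (\<lambda>row. row \<noteq> []) (T[r := butlast (T ! r)])"


text \<open>
  Forward slides of the empty box \<open>(r, c)\<close> (the value stored there is ignored) up to an
  outer corner.  The result is the new tableau and the row of the deleted corner.
\<close>

function slide :: "letter tableau \<Rightarrow> nat \<Rightarrow> nat \<Rightarrow> letter tableau \<times> nat" where
  "slide T r c =
     (let right = (Suc c < length (T ! r));
          below = (Suc r < length T \<and> c < length (T ! Suc r));
          x = T ! r ! Suc c;
          y = T ! Suc r ! c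
      in if right \<and> (\<not> below \<or> x < y \<or> x = y \<and> \<not> in_B0 x) then slide (put T r c x) r (Suc c)
         else if below then slide (put T r c y) (Suc r) c
         else (delete_box T r, r))"
  by pat_completeness auto
termination
proof (relation "measures [\<lambda>(T, r, c). length T - r, \<lambda>(T, r, c). length (T ! r) - c]", goal_cases)
  case 1
  show ?case by simp
next
  case (2 T r c right below x y)
  have "length (put T r c x ! r) = length (T ! r)"
    by (cases "r < length T") (auto simp: put_def list_update_beyond)
  then show ?case using 2 by (auto simp: put_def list_update_beyond)
next
  case (3 T r c right below x y)
  then show ?case by (auto simp: put_def list_update_beyond)
qed

declare slide.simps [simp del]


text \<open>
  \<open>bumps z z'\<close>: inserting \<open>z\<close> into a row would bump an entry \<open>z'\<close>, provided that it is
  the leftmost such entry.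
\<close>

definition bumps :: "letter \<Rightarrow> letter \<Rightarrow> bool" where
  "bumps z z' \<longleftrightarrow> (if in_B0 z then z < z' else z \<le> z')"

text \<open>Whether insertion added or removed a box, and the row of that box (always its last box).\<close>

datatype change = Added nat | Removed nat

function insert_from :: "letter tableau \<Rightarrow> nat \<Rightarrow> letter \<Rightarrow> letter tableau \<times> change" where
  "insert_from T r z =
     (if length T \<le> r \<or> (\<forall>z' \<in> set (T ! r). \<not> bumps z z') then (add_box T r z, Added r)
      else let c = (LEAST c. c < length (T ! r) \<and> bumps z (T ! r ! c));
               z' = T ! r ! c
           in if z = Plain (Suc r) \<and> z' = Barred (Suc r)
              then (let (T', r') = slide T r c in (T', Removed r'))
              else insert_from (put T r c z) (Suc r) z')"
  by pat_completeness auto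
termination
  by (relation "measure (\<lambda>(T, r, z). length T - r)") (auto simp: put_def list_update_beyond)

declare insert_from.simps [simp del]

definition spo_insert :: "letter tableau \<Rightarrow> letter \<Rightarrow> letter tableau \<times> change" where
  "spo_insert T x = insert_from T 0 x"


text \<open>
  Reverse RSK column insertion.  \<open>rev_bump P c x\<close> moves \<open>x\<close> out of column \<open>c\<close> to the left,
  where \<open>c = 0\<close> is the first column.  RSK column insertion of \<open>a\<close> into a column bumps the
  smallest entry that is at least \<open>a\<close> (this keeps columns strict), so its inverse has to
  replace the largest entry of the next column that does not exceed \<open>x\<close>; among equal
  entries of different columns, the one further to the left counts as the smaller one.
\<close>

fun rev_bump :: "nat tableau \<Rightarrow> nat \<Rightarrow> nat \<Rightarrow> nat tableau \<times> nat" where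
  "rev_bump P 0 x = (P, x)"
| "rev_bump P (Suc c) x =
     (let y = Max {P ! r ! c | r. r < length P \<and> c < length (P ! r) \<and> P ! r ! c \<le> x};
          r = (LEAST r. r < length P \<and> c < length (P ! r) \<and> P ! r ! c = y)
      in rev_bump (put P r c x) c y)"

definition rev_column_insert :: "nat tableau \<Rightarrow> nat \<Rightarrow> nat tableau \<times> nat" where
  "rev_column_insert P r = rev_bump (delete_box P r) (length (P ! r) - 1) (last (P ! r))"


definition two_line_ordered :: "('a::linorder \<times> 'b::linorder) list \<Rightarrow> bool" where
  "two_line_ordered w \<longleftrightarrow>
     (\<forall>k. Suc k < length w \<longrightarrow>
        fst (w ! k) \<le> fst (w ! Suc k) \<and>
        (fst (w ! k) = fst (w ! Suc k) \<longrightarrow> snd (w ! k) \<le> snd (w ! Suc k)))"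

definition two_line_arrays :: "nat \<Rightarrow> nat \<Rightarrow> nat \<Rightarrow> (nat \<times> letter) list set" where
  "two_line_arrays m n q =
     {w. set w \<subseteq> {1..q} \<times> (B0 m \<union> B1 n) \<and> two_line_ordered w \<and>
         (\<forall>i. \<forall>j \<in> B1 n. count_list w (i, j) \<le> 1)}"

definition burge_array :: "nat \<Rightarrow> (nat \<times> nat) list \<Rightarrow> bool" where
  "burge_array q L \<longleftrightarrow>
     set L \<subseteq> {1..q} \<times> {1..q - 1} \<and> two_line_ordered L \<and> (\<forall>(i, j) \<in> set L. j < i)"

type_synonym spo_state = "letter tableau \<times> nat tableau \<times> (nat \<times> nat) list"

fun spo_step :: "spo_state \<Rightarrow> nat \<times> letter \<Rightarrow> spo_state" where
  "spo_step (Pt, P, L) (i, j) =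
     (case spo_insert Pt j of
        (Pt', Added r) \<Rightarrow> (Pt', add_box P r i, L)
      | (Pt', Removed r) \<Rightarrow> (let (P', a) = rev_column_insert P r in (Pt', P', L @ [(i, a)])))"

definition spo_correspondence :: "(nat \<times> letter) list \<Rightarrow> spo_state" where
  "spo_correspondence w = foldl spo_step ([], [], []) w"

end

theory Submission
  imports Defs
begin

text \<open>
  The order relations on the rows and on the columns of an \<open>spo\<close>-tableau are negated converses of each other,
  so that bumping, sliding and the comparison of bumping routes behave as for ordinary
  row insertion.  The crux is the comparison of consecutive insertions of \<open>j\<close> and \<open>j'\<close>, where \<open>j\<close>
  precedes \<open>j'\<close> weakly in a row.  The second bumping route runs strictly to the right of the first.
  If the first one adds a box, then so does the second, weakly above; a cancellation in the second
  would force one in the first.  If both cancel, then the second cancellation happens weakly below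
  the first and to the left of its slide path, which it cannot cross, so that its corner is
  weakly below as well.  Thus, among columns with the same \<open>i\<close>, all removals come first and their corners
  move to the left, so that reverse column insertion ejects weakly increasing entries smaller than \<open>i\<close>;
  the added boxes then form a horizontal strip.
\<close>

section \<open>Tableaux with holes\<close>

text \<open>The row condition of both alphabets at once: \<open>x\<close> may stand to the left of
  \<open>y\<close>. Dually, \<open>\<not> rle y x\<close> says that \<open>y\<close> may stand below
  \<open>x\<close>.\<close>

definition rle :: "letter \<Rightarrow> letter \<Rightarrow> bool" where
  "rle x y \<longleftrightarrow> x < y \<or> x = y \<and> in_B0 x"

lemma not_rle: "\<not> rle y x \<longleftrightarrow> x < y \<or> x = y \<and> \<not> in_B0 x"
  by (auto simp: rle_def)

text \<open>An entry is bumped exactly when it may not stay to the left of \<open>z\<close>, so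
  insertion needs no case split between the alphabets.\<close>

lemma bumps_iff_not_rle: "bumps z z' \<longleftrightarrow> \<not> rle z' z"
  by (auto simp: bumps_def not_rle)

lemma rle_trans: "rle x y \<Longrightarrow> rle y z \<Longrightarrow> rle x z"
  by (auto simp: rle_def)

lemma not_rle_trans: "\<not> rle y x \<Longrightarrow> \<not> rle z y \<Longrightarrow> \<not> rle z x"
  by (auto simp: not_rle)

text \<open>Equality in a row needs a letter of \<open>B0\<close> and equality in a column one of
  \<open>B1\<close>, so a row step combined with a column step is strict. By
  \<open>less_imp_rle\<close> the result serves as either relation; this is how diagonal neighbours
  are compared.\<close>

lemma rle_not_rle_less: "rle x y \<Longrightarrow> \<not> rle z y \<Longrightarrow> x < z"
  unfolding not_rle by (auto simp: rle_def)

lemma not_rle_rle_less: "\<not> rle y x \<Longrightarrow> rle y z \<Longrightarrow> x < z"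
  unfolding not_rle by (auto simp: rle_def)

lemma less_imp_rle: "x < y \<Longrightarrow> rle x y" "x < y \<Longrightarrow> \<not> rle y x"
  by (auto simp: rle_def)

text \<open>Total in \<open>r\<close>, with value 0 below the tableau, so that
  \<open>c < rlen T r\<close> alone says that the box \<open>(r, c)\<close> exists.\<close>

definition rlen :: "'a tableau \<Rightarrow> nat \<Rightarrow> nat" where
  "rlen T r = (if r < length T then length (T ! r) else 0)"

text \<open>
  The relation \<open>le\<close> orders the rows and its reversed negation orders the columns, so that
  \<open>rle\<close> covers \<open>spo\<close>-tableaux and \<open>(\<le>)\<close> covers semistandard ones.  The entries
  stored in the boxes of \<open>H\<close> (the empty boxes) are ignored.
\<close>

definition tab ::
  "('a \<Rightarrow> 'a \<Rightarrow> bool) \<Rightarrow> (nat \<Rightarrow> 'a set) \<Rightarrow> (nat \<times> nat) set \<Rightarrow> 'a tableau \<Rightarrow> bool" where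
  "tab le A H T \<longleftrightarrow>
     (\<forall>r < length T. 0 < rlen T r) \<and> (\<forall>r. rlen T (Suc r) \<le> rlen T r) \<and>
     (\<forall>r c. c < rlen T r \<and> (r, c) \<notin> H \<longrightarrow> T ! r ! c \<in> A r) \<and>
     (\<forall>r c c'. c < c' \<and> c' < rlen T r \<and> (r, c) \<notin> H \<and> (r, c') \<notin> H \<longrightarrow>
        le (T ! r ! c) (T ! r ! c')) \<and>
     (\<forall>r r' c. r < r' \<and> c < rlen T r' \<and> (r, c) \<notin> H \<and> (r', c) \<notin> H \<longrightarrow>
        \<not> le (T ! r' ! c) (T ! r ! c))"

lemma rlen_pos_imp: "c < rlen T r \<Longrightarrow> r < length T"
  by (auto simp: rlen_def split: if_splits)

lemma tab_antimono:
  assumes "tab le A H T" "r \<le> r'"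
  shows "rlen T r' \<le> rlen T r"
  using assms lift_Suc_antimono_le[of "rlen T" r r'] by (auto simp: tab_def)

lemma tab_length_iff: "tab le A H T \<Longrightarrow> r < length T \<longleftrightarrow> 0 < rlen T r"
  by (auto simp: tab_def dest: rlen_pos_imp)

lemma tab_mem: "tab le A H T \<Longrightarrow> c < rlen T r \<Longrightarrow> (r, c) \<notin> H \<Longrightarrow> T ! r ! c \<in> A r"
  by (simp add: tab_def)

lemma tab_row:
  "tab le A H T \<Longrightarrow> c < c' \<Longrightarrow> c' < rlen T r \<Longrightarrow> (r, c) \<notin> H \<Longrightarrow> (r, c') \<notin> H \<Longrightarrow>
   le (T ! r ! c) (T ! r ! c')"
  by (simp add: tab_def)

lemma tab_col:
  "tab le A H T \<Longrightarrow> r < r' \<Longrightarrow> c < rlen T r' \<Longrightarrow> (r, c) \<notin> H \<Longrightarrow> (r', c) \<notin> H \<Longrightarrow>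
   \<not> le (T ! r' ! c) (T ! r ! c)"
  by (simp add: tab_def)

lemma tab_hole: "tab le A H T \<Longrightarrow> H \<subseteq> H' \<Longrightarrow> tab le A H' T"
  unfolding tab_def by (meson subsetD)

lemma tab_mono: "tab le A H T \<Longrightarrow> (\<And>r. A r \<subseteq> B r) \<Longrightarrow> tab le B H T"
  unfolding tab_def by (meson subsetD)

lemma length_put [simp]: "length (put T r c x) = length T"
  by (simp add: put_def)

lemma rlen_put [simp]: "rlen (put T r c x) = rlen T"
proof
  fix k
  show "rlen (put T r c x) k = rlen T k"
    by (cases "k = r") (auto simp: rlen_def put_def)
qed

lemma nth_put:
  "c < rlen T r \<Longrightarrow> put T r c x ! r' ! c' = (if r' = r \<and> c' = c then x else T ! r' ! c')"
  by (auto simp: rlen_def put_def nth_list_update split: if_splits)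

text \<open>Filling a box affects only its own row and column, and the other holes impose nothing.
  Slides, bumping and reverse bumping all reduce to this lemma.\<close>

lemma tab_put:
  assumes T: "tab le A H T" and c: "c < rlen T r" and x: "x \<in> A r"
    and left: "\<And>c'. c' < c \<Longrightarrow> (r, c') \<notin> H \<Longrightarrow> le (T ! r ! c') x"
    and right: "\<And>c'. c < c' \<Longrightarrow> c' < rlen T r \<Longrightarrow> (r, c') \<notin> H \<Longrightarrow> le x (T ! r ! c')"
    and up: "\<And>k. k < r \<Longrightarrow> (k, c) \<notin> H \<Longrightarrow> \<not> le x (T ! k ! c)"
    and down: "\<And>k. r < k \<Longrightarrow> c < rlen T k \<Longrightarrow> (k, c) \<notin> H \<Longrightarrow> \<not> le (T ! k ! c) x"
  shows "tab le A (H - {(r, c)}) (put T r c x)"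
proof -
  note nth = nth_put[OF c, of x]
  show ?thesis
    unfolding tab_def
  proof (intro conjI allI impI)
    fix k k' d
    assume *: "k < k' \<and> d < rlen (put T r c x) k' \<and> (k, d) \<notin> H - {(r, c)} \<and> (k', d) \<notin> H - {(r, c)}"
    consider "k = r \<and> d = c" | "k' = r \<and> d = c" | "\<not> (k = r \<and> d = c)" "\<not> (k' = r \<and> d = c)"
      by blast
    then show "\<not> le (put T r c x ! k' ! d) (put T r c x ! k ! d)"
      by cases (use * T up down in \<open>auto simp: nth tab_def\<close>)
  next
    fix k d d'
    assume *: "d < d' \<and> d' < rlen (put T r c x) k \<and> (k, d) \<notin> H - {(r, c)} \<and> (k, d') \<notin> H - {(r, c)}"
    consider "k = r \<and> d = c" | "k = r \<and> d' = c" | "\<not> (k = r \<and> d = c)" "\<not> (k = r \<and> d' = c)"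
      by blast
    then show "le (put T r c x ! k ! d) (put T r c x ! k ! d')"
      by cases (use * T left right in \<open>auto simp: nth tab_def\<close>)
  next
    fix k d
    assume *: "d < rlen (put T r c x) k \<and> (k, d) \<notin> H - {(r, c)}"
    then show "put T r c x ! k ! d \<in> A k"
      using T x by (cases "k = r \<and> d = c") (auto simp: nth tab_def)
  qed (use T in \<open>auto simp: tab_def\<close>)
qed

lemma tab_empty: "tab le A H []"
  by (simp add: tab_def rlen_def)

section \<open>Adding and deleting a box at the end of a row\<close>

definition addable :: "'a tableau \<Rightarrow> nat \<Rightarrow> bool" where
  "addable T r \<longleftrightarrow> (\<forall>k. r = Suc k \<longrightarrow> rlen T r < rlen T k)"

lemma addable_le_length: "addable T r \<Longrightarrow> r \<le> length T"
  by (cases r) (auto simp: addable_def dest: rlen_pos_imp)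

lemma rlen_add_box:
  "r \<le> length T \<Longrightarrow> rlen (add_box T r x) = (rlen T)(r := Suc (rlen T r))"
  by (rule ext) (auto simp: rlen_def add_box_def nth_append nth_list_update)

lemma nth_add_box:
  "r \<le> length T \<Longrightarrow> c' < rlen (add_box T r x) r' \<Longrightarrow>
   add_box T r x ! r' ! c' = (if r' = r \<and> c' = rlen T r then x else T ! r' ! c')"
  by (auto simp: rlen_def add_box_def nth_append nth_list_update split: if_splits)

lemma length_add_box: "r \<le> length T \<Longrightarrow> length (add_box T r x) = max (length T) (Suc r)"
  by (auto simp: add_box_def)

text \<open>The new box is the last of its row and the lowest of its column, so only entries to the
  left and above have to be compared with \<open>x\<close>.\<close>

lemma tab_add_box:
  assumes T: "tab le A {} T" and r: "addable T r" and x: "x \<in> A r"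
    and row: "\<And>c. c < rlen T r \<Longrightarrow> le (T ! r ! c) x"
    and col: "\<And>k. k < r \<Longrightarrow> \<not> le x (T ! k ! rlen T r)"
  shows "tab le A {} (add_box T r x)"
proof -
  note rl = addable_le_length[OF r]
  let ?T = "add_box T r x"
  have old: "?T ! r' ! c' = T ! r' ! c'" if "c' < rlen T r'" for r' c'
    using that nth_add_box[OF rl, of c' x r'] by (cases "r' = r") (auto simp: rlen_add_box[OF rl])
  have new: "?T ! r ! rlen T r = x"
    using nth_add_box[OF rl, of "rlen T r" x r] rlen_add_box[OF rl, of x] by auto
  have box: "c < rlen ?T k \<longleftrightarrow> c < rlen T k \<or> k = r \<and> c = rlen T r" for k c
    by (auto simp: rlen_add_box[OF rl])
  have shp: "rlen T (Suc k) \<le> rlen T k" for k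
    using T by (auto simp: tab_def)
  have "0 < rlen ?T k" if "k < length ?T" for k
  proof (cases "k = r")
    case False
    then have "k < length T" using that rl by (simp add: length_add_box[OF rl] max_def split: if_splits)
    then show ?thesis using False tab_length_iff[OF T, of k] by (simp add: rlen_add_box[OF rl])
  qed (simp add: rlen_add_box[OF rl])
  moreover have "rlen ?T (Suc k) \<le> rlen ?T k" for k
    using shp[of k] r by (auto simp: rlen_add_box[OF rl] addable_def)
  moreover have "?T ! k ! c \<in> A k" if "c < rlen ?T k" for k c
    using that x tab_mem[OF T] by (auto simp: box old new)
  moreover have "le (?T ! k ! c) (?T ! k ! c')" if "c < c'" "c' < rlen ?T k" for k c c'
    using that row tab_row[OF T, of c c' k] by (auto simp: box old new)
  moreover have "\<not> le (?T ! k' ! c) (?T ! k ! c)" if "k < k'" "c < rlen ?T k'" for k k' c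
  proof (cases "c < rlen T k'")
    case True
    then have "c < rlen T k" using tab_antimono[OF T, of k k'] that by auto
    then show ?thesis using True that tab_col[OF T] by (auto simp: old)
  next
    case False
    then have k': "k' = r" "c = rlen T r" using that by (auto simp: box)
    obtain j where j: "r = Suc j" using \<open>k < k'\<close> k' by (cases r) auto
    have "rlen T r < rlen T k"
      using tab_antimono[OF T, of k j] r that k' j by (auto simp: addable_def)
    then show ?thesis using k' col that by (auto simp: old new)
  qed
  ultimately show ?thesis by (auto simp: tab_def)
qed

definition corner :: "'a tableau \<Rightarrow> nat \<Rightarrow> bool" where
  "corner T r \<longleftrightarrow> rlen T (Suc r) < rlen T r"

text \<open>Since \<open>T\<close> has no empty rows and row \<open>r\<close> ends in a corner,
  deletion can empty only the last row. Hence the filter in \<open>delete_box\<close> never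
  renumbers a surviving row.\<close>

lemma delete_box_props:
  assumes T: "tab le A H T" and r: "corner T r"
  shows "rlen (delete_box T r) = (rlen T)(r := rlen T r - 1)" (is ?a)
    and "\<And>k c. c < rlen (delete_box T r) k \<Longrightarrow> delete_box T r ! k ! c = T ! k ! c"
    and "k < length (delete_box T r) \<longleftrightarrow> 0 < rlen (delete_box T r) k" (is ?c)
proof -
  have rT: "r < length T" "rlen T r = length (T ! r)"
    using r by (auto simp: corner_def rlen_def split: if_splits)
  have ne: "T ! k \<noteq> []" if "k < length T" for k
    using tab_length_iff[OF T, of k] that by (auto simp: rlen_def)
  let ?U = "T[r := butlast (T ! r)]"
  have D: "delete_box T r = (if length (T ! r) = 1 then take r T else ?U)"
  proof (cases "length (T ! r) = 1")
    case True
    then have "rlen T (Suc r) = 0" using r rT by (auto simp: corner_def)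
    then have "length T = Suc r"
      using rT ne[of "Suc r"] by (auto simp: rlen_def split: if_splits)
    then have "T = take r T @ [T ! r]"
      using rT by (metis take_Suc_conv_app_nth take_all_iff order_refl)
    moreover have "length (take r T) = r" using rT by simp
    ultimately have "?U = take r T @ [butlast (T ! r)]"
      by (metis list_update_length)
    moreover have "butlast (T ! r) = []"
      using True by (cases "T ! r") auto
    moreover have "filter (\<lambda>row. row \<noteq> []) (take r T) = take r T"
      using ne by (auto simp: filter_id_conv in_set_conv_nth)
    ultimately show ?thesis using True by (simp add: delete_box_def)
  next
    case False
    have "butlast (T ! r) \<noteq> []"
      using False ne[OF rT(1)] by (cases "T ! r" rule: rev_cases) auto
    then have "?U ! k \<noteq> []" if "k < length T" for k
      using ne[OF that] that by (cases "k = r") auto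
    then have "filter (\<lambda>row. row \<noteq> []) ?U = ?U"
      by (auto simp: filter_id_conv in_set_conv_nth)
    then show ?thesis using False by (simp add: delete_box_def)
  qed
  have last: "length T = Suc r" if "length (T ! r) = 1"
  proof -
    have "rlen T (Suc r) = 0" using r rT that by (auto simp: corner_def)
    then show ?thesis
      using rT(1) ne[of "Suc r"] by (auto simp: rlen_def split: if_splits)
  qed
  have U: "rlen ?U = (rlen T)(r := rlen T r - 1)"
  proof
    fix k show "rlen ?U k = ((rlen T)(r := rlen T r - 1)) k"
      by (cases "k = r") (simp_all add: rlen_def)
  qed
  have D': "rlen (delete_box T r) = rlen ?U"
  proof
    fix k show "rlen (delete_box T r) k = rlen ?U k"
    proof (cases "length (T ! r) = 1")
      case True
      then have "rlen ?U k = (if k < r then rlen T k else 0)"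
        using rT last[OF True] by (simp only: U fun_upd_apply) (simp add: rlen_def)
      then show ?thesis using D True rT(1) by (simp add: rlen_def)
    qed (simp add: D)
  qed
  then show ?a by (simp add: U)
  show "delete_box T r ! k ! c = T ! k ! c" if c: "c < rlen (delete_box T r) k" for k c
  proof (cases "length (T ! r) = 1")
    case True
    then show ?thesis using D c by (simp add: rlen_def split: if_splits)
  next
    case False
    then show ?thesis using D c by (cases "k = r") (simp_all add: rlen_def nth_butlast split: if_splits)
  qed
  show ?c
  proof (cases "k < length (delete_box T r)")
    case True
    have "delete_box T r ! k \<noteq> []"
    proof (cases "length (T ! r) = 1")
      case one: True
      then show ?thesis using D True ne[of k] rT(1) by simp
    next
      case False
      then have "butlast (T ! r) \<noteq> []"
        using ne[OF rT(1)] by (cases "T ! r" rule: rev_cases) auto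
      then show ?thesis using D True False ne[of k] rT(1) by (cases "k = r") simp_all
    qed
    then show ?thesis using True by (simp add: rlen_def)
  qed (simp add: rlen_def)
qed

lemma tab_delete_box:
  assumes T: "tab le A H T" and r: "corner T r" and H: "H \<subseteq> {(r, rlen T r - 1)}"
  shows "tab le A {} (delete_box T r)"
proof -
  note D = delete_box_props[OF T r]
  have box: "c < rlen T k \<and> (k, c) \<notin> H" if "c < rlen (delete_box T r) k" for k c
    using that H by (auto simp: D(1) split: if_splits)
  have shp: "rlen T (Suc k) \<le> rlen T k" for k
    using T by (auto simp: tab_def)
  have "rlen (delete_box T r) (Suc k) \<le> rlen (delete_box T r) k" for k
    using shp[of k] r by (auto simp: D(1) corner_def)
  then have anti: "rlen (delete_box T r) k' \<le> rlen (delete_box T r) k" if "k \<le> k'" for k k'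
    using lift_Suc_antimono_le[of "rlen (delete_box T r)"] that by auto
  show ?thesis
    unfolding tab_def
  proof (intro conjI allI impI)
    fix k assume "k < length (delete_box T r)"
    then show "0 < rlen (delete_box T r) k" by (simp only: D(3))
  next
    fix k show "rlen (delete_box T r) (Suc k) \<le> rlen (delete_box T r) k" by (rule anti) simp
  next
    fix k c assume "c < rlen (delete_box T r) k \<and> (k, c) \<notin> {}"
    then show "delete_box T r ! k ! c \<in> A k" using T box[of c k] D(2) by (auto simp: tab_def)
  next
    fix k c c' assume "c < c' \<and> c' < rlen (delete_box T r) k \<and> (k, c) \<notin> {} \<and> (k, c') \<notin> {}"
    then show "le (delete_box T r ! k ! c) (delete_box T r ! k ! c')"
      using T box[of c' k] box[of c k] D(2) by (auto simp: tab_def)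
  next
    fix k k' c assume "k < k' \<and> c < rlen (delete_box T r) k' \<and> (k, c) \<notin> {} \<and> (k', c) \<notin> {}"
    then show "\<not> le (delete_box T r ! k' ! c) (delete_box T r ! k ! c)"
      using T box[of c k'] box[of c k] D(2) anti[of k k'] by (auto simp: tab_def)
  qed
qed

section \<open>Forward slides and insertion\<close>

text \<open>Induction along the slide path. The tie rules of the two alphabets merge into one: with
  both neighbours present, the hole moves right exactly when the entry below it may stand under the
  entry to its right.\<close>

lemma slide_rule [consumes 1, case_names right down stop]:
  assumes "c < rlen T r"
    and right: "\<And>T r c. \<lbrakk>c < rlen T r; Suc c < rlen T r;
        c < rlen T (Suc r) \<Longrightarrow> \<not> rle (T ! Suc r ! c) (T ! r ! Suc c);
        slide T r c = slide (put T r c (T ! r ! Suc c)) r (Suc c);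
        Q (put T r c (T ! r ! Suc c)) r (Suc c)\<rbrakk> \<Longrightarrow> Q T r c"
    and down: "\<And>T r c. \<lbrakk>c < rlen T r; c < rlen T (Suc r);
        Suc c < rlen T r \<Longrightarrow> rle (T ! Suc r ! c) (T ! r ! Suc c);
        slide T r c = slide (put T r c (T ! Suc r ! c)) (Suc r) c;
        Q (put T r c (T ! Suc r ! c)) (Suc r) c\<rbrakk> \<Longrightarrow> Q T r c"
    and stop: "\<And>T r c. \<lbrakk>rlen T r = Suc c; rlen T (Suc r) \<le> c; slide T r c = (delete_box T r, r)\<rbrakk>
        \<Longrightarrow> Q T r c"
  shows "Q T r c"
  using assms(1)
proof (induction T r c rule: slide.induct)
  case (1 T r c)
  have r: "r < length T" "rlen T r = length (T ! r)"
    using 1(3) by (auto simp: rlen_def split: if_splits)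
  have below: "c < rlen T (Suc r) \<longleftrightarrow> Suc r < length T \<and> c < length (T ! Suc r)"
    by (auto simp: rlen_def)
  have cmp: "x < y \<or> x = y \<and> \<not> in_B0 x \<longleftrightarrow> \<not> rle y x" for x y
    by (simp add: not_rle)
  consider (R) "Suc c < rlen T r" "c < rlen T (Suc r) \<Longrightarrow> \<not> rle (T ! Suc r ! c) (T ! r ! Suc c)"
    | (D) "c < rlen T (Suc r)" "Suc c < rlen T r \<Longrightarrow> rle (T ! Suc r ! c) (T ! r ! Suc c)"
    | (S) "\<not> Suc c < rlen T r" "\<not> c < rlen T (Suc r)"
    by blast
  then show ?case
  proof cases
    case R
    have "slide T r c = slide (put T r c (T ! r ! Suc c)) r (Suc c)"
      by (subst slide.simps) (use R in \<open>auto simp: Let_def cmp below r\<close>)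
    moreover have "Q (put T r c (T ! r ! Suc c)) r (Suc c)"
      using R r by (intro 1(1)[OF refl refl refl refl]) (auto simp: cmp below)
    ultimately show ?thesis using R 1(3) right by blast
  next
    case D
    have "slide T r c = slide (put T r c (T ! Suc r ! c)) (Suc r) c"
      by (subst slide.simps) (use D in \<open>auto simp: Let_def cmp below r\<close>)
    moreover have "Q (put T r c (T ! Suc r ! c)) (Suc r) c"
      using D r by (intro 1(2)[OF refl refl refl refl]) (auto simp: cmp below)
    ultimately show ?thesis using D 1(3) down by blast
  next
    case S
    have "slide T r c = (delete_box T r, r)"
      by (subst slide.simps) (use S in \<open>auto simp: Let_def below r\<close>)
    then show ?thesis using S 1(3) stop by simp
  qed
qed

lemma tab_slide_right:
  assumes T: "tab rle A {(r, c)} T" and c: "Suc c < rlen T r"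
    and below: "c < rlen T (Suc r) \<Longrightarrow> \<not> rle (T ! Suc r ! c) (T ! r ! Suc c)"
  shows "tab rle A {(r, Suc c)} (put T r c (T ! r ! Suc c))"
proof -
  let ?x = "T ! r ! Suc c"
  \<comment> \<open>The old copy of \<open>?x\<close> is still stored at \<open>(r, Suc c)\<close>,
    so that box is declared a hole before \<open>(r, c)\<close> is filled.\<close>
  have "tab rle A ({(r, c), (r, Suc c)} - {(r, c)}) (put T r c ?x)"
  proof (rule tab_put)
    show "tab rle A {(r, c), (r, Suc c)} T"
      using T by (rule tab_hole) simp
    show "c < rlen T r" using c by simp
    show "?x \<in> A r" using tab_mem[OF T c] by simp
    show "rle (T ! r ! c') ?x" if "c' < c" for c'
      using tab_row[OF T _ c, of c'] that by simp
    show "rle ?x (T ! r ! c')" if "c < c'" "c' < rlen T r" "(r, c') \<notin> {(r, c), (r, Suc c)}" for c'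
      using tab_row[OF T _ that(2), of "Suc c"] that by auto
    show "\<not> rle (T ! k ! c) ?x" if "r < k" "c < rlen T k" for k
    proof (cases "k = Suc r")
      case False
      have "c < rlen T (Suc r)" using tab_antimono[OF T, of "Suc r" k] that by simp
      moreover have "\<not> rle (T ! k ! c) (T ! Suc r ! c)"
        using tab_col[OF T _ that(2), of "Suc r"] False that by auto
      ultimately show ?thesis using below not_rle_trans by blast
    qed (use below that in auto)
    \<comment> \<open>The comparison passes through the entry of row \<open>k\<close> in column
      \<open>Suc c\<close>, which stood above \<open>?x\<close>: a row step, then a column
      step.\<close>
    show "\<not> rle ?x (T ! k ! c)" if "k < r" for k
    proof -
      have k: "Suc c < rlen T k"
        using tab_antimono[OF T, of k r] that c by simp
      have "\<not> rle ?x (T ! k ! Suc c)"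
        using tab_col[OF T that c] by simp
      moreover have "rle (T ! k ! c) (T ! k ! Suc c)"
        using tab_row[OF T _ k, of c] that by auto
      ultimately show ?thesis using rle_not_rle_less less_imp_rle by blast
    qed
  qed
  then show ?thesis by simp
qed

text \<open>Row alphabets shrink downwards, so an entry that moves up stays admissible.\<close>

lemma tab_slide_down:
  assumes T: "tab rle A {(r, c)} T" and c: "c < rlen T (Suc r)" and A: "A (Suc r) \<subseteq> A r"
    and right: "Suc c < rlen T r \<Longrightarrow> rle (T ! Suc r ! c) (T ! r ! Suc c)"
  shows "tab rle A {(Suc r, c)} (put T r c (T ! Suc r ! c))"
proof -
  let ?y = "T ! Suc r ! c"
  have "tab rle A ({(r, c), (Suc r, c)} - {(r, c)}) (put T r c ?y)"
  proof (rule tab_put)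
    show "tab rle A {(r, c), (Suc r, c)} T"
      using T by (rule tab_hole) simp
    show "c < rlen T r" using c tab_antimono[OF T, of r "Suc r"] by simp
    show "?y \<in> A r" using tab_mem[OF T c] A by auto
    show "\<not> rle ?y (T ! k ! c)" if "k < r" for k
      using tab_col[OF T _ c, of k] that by simp
    show "\<not> rle (T ! k ! c) ?y" if "r < k" "c < rlen T k" "(k, c) \<notin> {(r, c), (Suc r, c)}" for k
      using tab_col[OF T _ that(2), of "Suc r"] that by auto
    show "rle ?y (T ! r ! c')" if "c < c'" "c' < rlen T r" for c'
    proof (cases "c' = Suc c")
      case False
      then have "rle (T ! r ! Suc c) (T ! r ! c')"
        using tab_row[OF T _ that(2), of "Suc c"] that by auto
      moreover have "Suc c < rlen T r" using that by simp
      ultimately show ?thesis using right rle_trans by blast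
    qed (use right that in auto)
    show "rle (T ! r ! c') ?y" if "c' < c" for c'
    proof -
      have "rle (T ! Suc r ! c') ?y" using tab_row[OF T that c] by simp
      moreover have "\<not> rle (T ! Suc r ! c') (T ! r ! c')"
        using tab_col[OF T, of r "Suc r" c'] that c by simp
      ultimately show ?thesis using not_rle_rle_less less_imp_rle by blast
    qed
  qed
  then show ?thesis by simp
qed

text \<open>The path only goes right and down, so the rows above its start and the boxes to the left
  of its start keep their entries.\<close>

lemma slide_tab:
  assumes "c < rlen T r" "tab rle A {(r, c)} T" "\<And>k. A (Suc k) \<subseteq> A k" "slide T r c = (T', s)"
  shows "tab rle A {} T' \<and> r \<le> s \<and> corner T s \<and> rlen T' = (rlen T)(s := rlen T s - 1) \<and>
    (\<forall>k c'. c' < rlen T' k \<and> (k < r \<or> k = r \<and> c' < c) \<longrightarrow> T' ! k ! c' = T ! k ! c')"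
  using assms(1,2,4)
proof (induction T r c rule: slide_rule)
  case (right T r c)
  let ?x = "T ! r ! Suc c"
  note T = right.prems(1)
  have "tab rle A {(r, Suc c)} (put T r c ?x)"
    using T right(2,3) by (rule tab_slide_right)
  moreover have "slide (put T r c ?x) r (Suc c) = (T', s)"
    using right.prems(2) right(4) by simp
  ultimately have IH: "tab rle A {} T' \<and> r \<le> s \<and> corner (put T r c ?x) s \<and>
      rlen T' = (rlen (put T r c ?x))(s := rlen (put T r c ?x) s - 1) \<and>
      (\<forall>k c'. c' < rlen T' k \<and> (k < r \<or> k = r \<and> c' < Suc c) \<longrightarrow> T' ! k ! c' = put T r c ?x ! k ! c')"
    by (rule right.IH)
  moreover have "put T r c ?x ! k ! c' = T ! k ! c'" if "k < r \<or> k = r \<and> c' < c" for k c'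
    using that by (auto simp: nth_put[OF right(1)])
  ultimately show ?case unfolding corner_def by auto
next
  case (down T r c)
  let ?y = "T ! Suc r ! c"
  note T = down.prems(1)
  have "tab rle A {(Suc r, c)} (put T r c ?y)"
    using T down(2) assms(3) down(3) by (rule tab_slide_down)
  moreover have "slide (put T r c ?y) (Suc r) c = (T', s)"
    using down.prems(2) down(4) by simp
  ultimately have IH: "tab rle A {} T' \<and> Suc r \<le> s \<and> corner (put T r c ?y) s \<and>
      rlen T' = (rlen (put T r c ?y))(s := rlen (put T r c ?y) s - 1) \<and>
      (\<forall>k c'. c' < rlen T' k \<and> (k < Suc r \<or> k = Suc r \<and> c' < c) \<longrightarrow>
        T' ! k ! c' = put T r c ?y ! k ! c')"
    by (rule down.IH)
  moreover have "put T r c ?y ! k ! c' = T ! k ! c'" if "k < r \<or> k = r \<and> c' < c" for k c'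
    using that by (auto simp: nth_put[OF down(1)])
  ultimately show ?case unfolding corner_def by auto
next
  case (stop T r c)
  have r: "corner T r" using stop by (auto simp: corner_def)
  have *: "T' = delete_box T r" "s = r" using stop by auto
  have "tab rle A {} T'"
    unfolding * by (rule tab_delete_box[OF stop(4) r]) (simp add: stop(1))
  then show ?case
    using r delete_box_props[OF stop(4) r] by (simp add: *)
qed

section \<open>Row alphabets and the insertion of one letter\<close>

definition spo_row :: "nat \<Rightarrow> nat \<Rightarrow> nat \<Rightarrow> letter set" where
  "spo_row m n r = {x \<in> B0 m \<union> B1 n. Plain (Suc r) \<le> x}"

lemma spo_row_Suc: "spo_row m n (Suc r) \<subseteq> spo_row m n r"
proof -
  have "Plain (Suc r) \<le> Plain (Suc (Suc r))" by (simp add: less_eq_letter_def)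
  then show ?thesis by (auto simp: spo_row_def)
qed

text \<open>An entry that \<open>z\<close> bumps out of row \<open>r\<close> violates the bound of
  row \<open>Suc r\<close> only if it is \<open>Barred (Suc r)\<close>, and then \<open>z\<close>
  can only be \<open>Plain (Suc r)\<close>. This pair is exactly the cancellation.\<close>

lemma spo_row_bumped:
  assumes "z \<in> spo_row m n r" "x \<in> spo_row m n r" "\<not> rle x z"
    "\<not> (z = Plain (Suc r) \<and> x = Barred (Suc r))"
  shows "x \<in> spo_row m n (Suc r)"
  using assms unfolding spo_row_def not_rle
  by (cases z; cases x) (auto simp: less_letter_def less_eq_letter_def B0_def B1_def, presburger+)

text \<open>One step of \<open>insert_from\<close>, with the leftmost bumped column described by its
  properties. As \<open>rlen\<close> vanishes below the tableau, an empty row falls under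
  \<open>add\<close>.\<close>

lemma insert_cases:
  obtains (add) "\<forall>c < rlen T r. rle (T ! r ! c) z" "insert_from T r z = (add_box T r z, Added r)"
  | (cancel) c where "c < rlen T r" "z = Plain (Suc r)" "T ! r ! c = Barred (Suc r)"
      "\<forall>c' < c. rle (T ! r ! c') z"
      "insert_from T r z = (fst (slide T r c), Removed (snd (slide T r c)))"
  | (bump) c where "c < rlen T r" "\<not> rle (T ! r ! c) z" "\<forall>c' < c. rle (T ! r ! c') z"
      "\<not> (z = Plain (Suc r) \<and> T ! r ! c = Barred (Suc r))"
      "insert_from T r z = insert_from (put T r c z) (Suc r) (T ! r ! c)"
proof (cases "\<forall>c < rlen T r. rle (T ! r ! c) z")
  case True
  then have "length T \<le> r \<or> (\<forall>z' \<in> set (T ! r). \<not> bumps z z')"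
    by (auto simp: rlen_def bumps_iff_not_rle in_set_conv_nth split: if_splits)
  then have "insert_from T r z = (add_box T r z, Added r)"
    by (subst insert_from.simps) auto
  with True add show thesis by blast
next
  case False
  then have r: "r < length T" by (auto simp: rlen_def split: if_splits)
  then have rl: "rlen T r = length (T ! r)" by (simp add: rlen_def)
  have ex: "\<exists>c. c < length (T ! r) \<and> bumps z (T ! r ! c)"
    using False by (auto simp: rl bumps_iff_not_rle)
  then have nt: "\<not> (length T \<le> r \<or> (\<forall>z' \<in> set (T ! r). \<not> bumps z z'))"
    using r by (metis linorder_not_le nth_mem)
  define c where "c = (LEAST c. c < length (T ! r) \<and> bumps z (T ! r ! c))"
  have c: "c < rlen T r" "\<not> rle (T ! r ! c) z"
    using LeastI_ex[OF ex] by (auto simp: c_def rl bumps_iff_not_rle)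
  have c': "\<forall>c' < c. rle (T ! r ! c') z"
  proof (intro allI impI)
    fix c' assume "c' < c"
    then have "\<not> (c' < length (T ! r) \<and> bumps z (T ! r ! c'))"
      unfolding c_def by (rule not_less_Least)
    with c \<open>c' < c\<close> show "rle (T ! r ! c') z" by (auto simp: rl bumps_iff_not_rle)
  qed
  have eq: "insert_from T r z =
      (if z = Plain (Suc r) \<and> T ! r ! c = Barred (Suc r)
       then (fst (slide T r c), Removed (snd (slide T r c)))
       else insert_from (put T r c z) (Suc r) (T ! r ! c))"
    unfolding insert_from.simps[of T r z] if_not_P[OF nt] Let_def c_def[symmetric]
    by (simp add: case_prod_beta)
  show thesis
  proof (cases "z = Plain (Suc r) \<and> T ! r ! c = Barred (Suc r)")
    case True
    have "insert_from T r z = (fst (slide T r c), Removed (snd (slide T r c)))"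
      by (rule eq[unfolded if_P[OF True]])
    with True c c' cancel show thesis by blast
  next
    case F: False
    have "insert_from T r z = insert_from (put T r c z) (Suc r) (T ! r ! c)"
      by (rule eq[unfolded if_not_P[OF F]])
    with F c c' bump show thesis by blast
  qed
qed

lemma insert_rule [case_names add cancel bump]:
  assumes add: "\<And>T r z. \<lbrakk>\<forall>c < rlen T r. rle (T ! r ! c) z;
      insert_from T r z = (add_box T r z, Added r)\<rbrakk> \<Longrightarrow> Q T r z"
    and cancel: "\<And>T r z c. \<lbrakk>c < rlen T r; z = Plain (Suc r); T ! r ! c = Barred (Suc r);
      \<forall>c' < c. rle (T ! r ! c') z;
      insert_from T r z = (fst (slide T r c), Removed (snd (slide T r c)))\<rbrakk> \<Longrightarrow> Q T r z"
    and bump: "\<And>T r z c. \<lbrakk>c < rlen T r; \<not> rle (T ! r ! c) z; \<forall>c' < c. rle (T ! r ! c') z;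
      \<not> (z = Plain (Suc r) \<and> T ! r ! c = Barred (Suc r));
      insert_from T r z = insert_from (put T r c z) (Suc r) (T ! r ! c);
      Q (put T r c z) (Suc r) (T ! r ! c)\<rbrakk> \<Longrightarrow> Q T r z"
  shows "Q T r z"
proof (induction "length T - r" arbitrary: T r z rule: less_induct)
  case (less T r z)
  show ?case
  proof (cases rule: insert_cases[where T = T and r = r and z = z])
    case bump': (bump c)
    have "length (put T r c z) - Suc r < length T - r"
      using rlen_pos_imp[OF bump'(1)] by simp
    then show ?thesis by (rule bump[OF bump' less.hyps])
  qed (use add cancel in blast)+
qed

text \<open>
  The state of the insertion of \<open>z\<close> into row \<open>r\<close>: if \<open>z\<close> was bumped from column \<open>c0\<close> of the
  row above, then it can only land in a column up to \<open>c0\<close>, where it fits under the row above.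
\<close>

definition insertable :: "(nat \<Rightarrow> letter set) \<Rightarrow> letter tableau \<Rightarrow> nat \<Rightarrow> letter \<Rightarrow> bool" where
  "insertable A T r z \<longleftrightarrow> tab rle A {} T \<and> z \<in> A r \<and>
     (\<forall>k. r = Suc k \<longrightarrow> (\<exists>c0 < rlen T k. (\<forall>c \<le> c0. \<not> rle z (T ! k ! c)) \<and>
        (c0 < rlen T r \<longrightarrow> \<not> rle (T ! r ! c0) z)))"

text \<open>Bumping routes move weakly to the left: if \<open>c\<close> exceeded the column
  \<open>c0\<close> of the previous bump, then the entry at \<open>c0\<close> would have to precede
  \<open>z\<close>, which \<open>insertable\<close> excludes. Allowing \<open>c = rlen T r\<close>
  covers a new box at the end of the row.\<close>

lemma insertable_above:
  assumes I: "insertable A T r z" and c: "c \<le> rlen T r" "\<forall>c' < c. rle (T ! r ! c') z" and k: "k < r"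
  shows "c < rlen T k" "\<not> rle z (T ! k ! c)"
proof -
  have T: "tab rle A {} T" using I by (simp add: insertable_def)
  obtain j where j: "r = Suc j" using k by (cases r) auto
  obtain c0 where c0: "c0 < rlen T j" "\<forall>c \<le> c0. \<not> rle z (T ! j ! c)"
    "c0 < rlen T r \<longrightarrow> \<not> rle (T ! r ! c0) z"
    using I j by (auto simp: insertable_def)
  have "c \<le> c0" using c c0(3) by (meson leI order_less_le_trans)
  then have cj: "c < rlen T j" "\<not> rle z (T ! j ! c)" using c0 by auto
  show "c < rlen T k" using cj tab_antimono[OF T, of k j] k j by simp
  show "\<not> rle z (T ! k ! c)"
  proof (cases "k = j")
    case False
    then have "\<not> rle (T ! j ! c) (T ! k ! c)" using tab_col[OF T, of k j c] k j cj by auto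
    then show ?thesis using cj not_rle_trans by blast
  qed (use cj in simp)
qed

text \<open>The bumped entry comes after everything now in columns up to \<open>c\<close>, and what
  lies under it comes after it. So \<open>c\<close> becomes the \<open>c0\<close> of the next
  row.\<close>

lemma insertable_put:
  assumes I: "insertable A T r z" and c: "c < rlen T r" "\<not> rle (T ! r ! c) z" "\<forall>c' < c. rle (T ! r ! c') z"
    and z': "T ! r ! c \<in> A (Suc r)"
  shows "insertable A (put T r c z) (Suc r) (T ! r ! c)"
proof -
  let ?z = "T ! r ! c"
  note nth = nth_put[OF c(1), of z]
  have T: "tab rle A {} T" and z: "z \<in> A r" using I by (simp_all add: insertable_def)
  have up: "\<not> rle z (T ! k ! c)" if "k < r" for k
    using insertable_above(2)[OF I _ c(3) that] c(1) by simp
  have down: "\<not> rle (T ! k ! c) z" if "r < k" "c < rlen T k" for k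
    using tab_col[OF T that] c(2) not_rle_trans by blast
  have right: "rle z (T ! r ! c')" if "c < c'" "c' < rlen T r" for c'
    using tab_row[OF T that] c(2) not_rle_rle_less less_imp_rle by blast
  have "tab rle A ({(r, c)} - {(r, c)}) (put T r c z)"
    by (rule tab_put) (use tab_hole[OF T] z up down right c in auto)
  then have "tab rle A {} (put T r c z)" by simp
  moreover have "\<not> rle ?z (put T r c z ! r ! c')" if "c' \<le> c" for c'
  proof (cases "c' = c")
    case False
    then have "rle (T ! r ! c') z" using c(3) that by simp
    then have "T ! r ! c' < ?z" using c(2) rle_not_rle_less by blast
    then show ?thesis using False less_imp_rle by (simp add: nth)
  qed (use c(2) in \<open>simp add: nth\<close>)
  moreover have "\<not> rle (put T r c z ! Suc r ! c) ?z" if "c < rlen T (Suc r)"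
    using tab_col[OF T _ that, of r] by (simp add: nth)
  ultimately show ?thesis using z' c(1) by (auto simp: insertable_def)
qed

definition changed :: "'a tableau \<Rightarrow> change \<Rightarrow> (nat \<Rightarrow> nat) \<Rightarrow> bool" where
  "changed T ch f \<longleftrightarrow> (case ch of
      Added s \<Rightarrow> addable T s \<and> f = (rlen T)(s := Suc (rlen T s))
    | Removed s \<Rightarrow> corner T s \<and> f = (rlen T)(s := rlen T s - 1))"

fun change_row :: "change \<Rightarrow> nat" where
  "change_row (Added s) = s"
| "change_row (Removed s) = s"

lemma changed_put [simp]: "changed (put T r c z) ch f = changed T ch f"
  by (auto simp: changed_def addable_def corner_def split: change.split)

lemma insertable_bump:
  assumes "insertable (spo_row m n) T r z" "c < rlen T r" "\<not> rle (T ! r ! c) z"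
    "\<forall>c' < c. rle (T ! r ! c') z" "\<not> (z = Plain (Suc r) \<and> T ! r ! c = Barred (Suc r))"
  shows "insertable (spo_row m n) (put T r c z) (Suc r) (T ! r ! c)"
proof (rule insertable_put[OF assms(1-4)])
  have "T ! r ! c \<in> spo_row m n r" "z \<in> spo_row m n r"
    using assms(1) tab_mem[OF _ assms(2), of rle "spo_row m n" "{}"] by (simp_all add: insertable_def)
  then show "T ! r ! c \<in> spo_row m n (Suc r)" using assms(3,5) by (intro spo_row_bumped)
qed

text \<open>Each bump passes \<open>insertable\<close> on to the next row, so only the final append
  or slide has to be checked. The clause about the rows above \<open>r\<close> allows two insertions
  to be compared row by row.\<close>

lemma insert_from_tab:
  assumes "insertable (spo_row m n) T r z" "insert_from T r z = (T', ch)"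
  shows "tab rle (spo_row m n) {} T' \<and> r \<le> change_row ch \<and> changed T ch (rlen T') \<and>
    (\<forall>k < r. \<forall>c < rlen T' k. T' ! k ! c = T ! k ! c)"
  using assms
proof (induction T r z rule: insert_rule)
  case (add T r z)
  have T: "tab rle (spo_row m n) {} T" and z: "z \<in> spo_row m n r"
    using add.prems by (simp_all add: insertable_def)
  note above = insertable_above[OF add.prems(1) order_refl add(1)]
  have ad: "addable T r" using above by (auto simp: addable_def)
  note rl = addable_le_length[OF ad]
  have "tab rle (spo_row m n) {} (add_box T r z)"
    using tab_add_box[OF T ad z] add(1) above by auto
  moreover have "add_box T r z ! k ! c = T ! k ! c" if "k < r" "c < rlen (add_box T r z) k" for k c
    using that nth_add_box[OF rl that(2)] by auto
  ultimately show ?case using add ad rl by (auto simp: changed_def rlen_add_box)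
next
  case (cancel T r z c)
  have T: "tab rle (spo_row m n) {(r, c)} T"
    using cancel.prems by (auto simp: insertable_def intro: tab_hole[rotated])
  have "slide T r c = (T', snd (slide T r c))" "ch = Removed (snd (slide T r c))"
    using cancel by (auto simp: prod_eq_iff)
  with slide_tab[OF cancel(1) T spo_row_Suc this(1)] show ?case
    by (auto simp: changed_def)
next
  case (bump T r z c)
  have "insertable (spo_row m n) (put T r c z) (Suc r) (T ! r ! c)"
    using insertable_bump bump by blast
  from bump.IH[OF this] bump show ?case
    by (auto simp: nth_put)
qed

section \<open>Comparing consecutive insertions\<close>

text \<open>
  The column in which a slide leaves row \<open>k\<close> is \<open>d k\<close>.  A later slide that starts to the
  left of this path cannot cross it: next to the path it has to move down.
\<close>

definition separates :: "letter tableau \<Rightarrow> nat \<Rightarrow> nat \<Rightarrow> (nat \<Rightarrow> nat) \<Rightarrow> bool" where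
  "separates T r s d \<longleftrightarrow> rlen T s \<le> d s \<and>
     (\<forall>k. r \<le> k \<and> k < s \<longrightarrow> d k < rlen T k \<and> d k \<le> d (Suc k) \<and> d k \<le> rlen T (Suc k) \<and>
        Plain (Suc (Suc k)) \<le> T ! k ! d k \<and> (\<forall>c < d k. rle (T ! Suc k ! c) (T ! k ! d k)))"

text \<open>Where the slide goes down it lifts an entry out of row \<open>Suc k\<close>. This entry
  is at least \<open>Plain (Suc (Suc k))\<close> and comes after all entries to its left in row
  \<open>Suc k\<close>, which stay in place. The first fact keeps later cancellations to the left of
  the path, the second turns later slides downwards.\<close>

lemma slide_separates:
  assumes "c < rlen T r" "tab rle (spo_row m n) {(r, c)} T" "slide T r c = (T', s)"
  shows "\<exists>d. c \<le> d r \<and> separates T' r s d"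
  using assms
proof (induction T r c rule: slide_rule)
  case (right T r c)
  have "tab rle (spo_row m n) {(r, Suc c)} (put T r c (T ! r ! Suc c))"
    using right.prems(1) right(2,3) by (rule tab_slide_right)
  moreover have "slide (put T r c (T ! r ! Suc c)) r (Suc c) = (T', s)"
    using right.prems(2) right(4) by simp
  ultimately show ?case using right.IH by (meson Suc_leD)
next
  case (down T r c)
  let ?y = "T ! Suc r ! c"
  note T = down.prems(1)
  have T2: "tab rle (spo_row m n) {(Suc r, c)} (put T r c ?y)"
    using T down(2) spo_row_Suc down(3) by (rule tab_slide_down)
  have sl: "slide (put T r c ?y) (Suc r) c = (T', s)"
    using down.prems(2) down(4) by simp
  obtain d where d: "c \<le> d (Suc r)" "separates T' (Suc r) s d"
    using down.IH[OF T2 sl] by blast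
  have box: "c < rlen (put T r c ?y) (Suc r)" using down(2) by simp
  have res: "Suc r \<le> s" "rlen T' = (rlen T)(s := rlen T s - 1)"
    "\<And>k c'. c' < rlen T' k \<Longrightarrow> k < Suc r \<or> k = Suc r \<and> c' < c \<Longrightarrow> T' ! k ! c' = put T r c ?y ! k ! c'"
    using slide_tab[OF box T2 spo_row_Suc sl] by auto
  have here: "c < rlen T' r" "T' ! r ! c = ?y"
    using res down(1) by (auto simp: nth_put[OF down(1)])
  have next_row: "c \<le> rlen T' (Suc r)" using res(2) down(2) by auto
  have "rle (T' ! Suc r ! c') ?y" if "c' < c" for c'
  proof -
    have "T' ! Suc r ! c' = T ! Suc r ! c'"
      using res(3)[of c' "Suc r"] that next_row by (simp add: nth_put[OF down(1)])
    then show ?thesis using tab_row[OF T that down(2)] by simp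
  qed
  moreover have "Plain (Suc (Suc r)) \<le> ?y"
    using tab_mem[OF T down(2)] by (simp add: spo_row_def)
  \<comment> \<open>The slide leaves row \<open>r\<close> in column \<open>c\<close>; the lower rows
    keep the columns from the induction hypothesis.\<close>
  ultimately have "separates T' r s (d(r := c))"
    unfolding separates_def
  proof (intro conjI allI impI)
    show "rlen T' s \<le> (d(r := c)) s" using d(2) res(1) by (simp add: separates_def)
  next
    fix k assume k: "r \<le> k \<and> k < s"
    let ?d = "d(r := c)"
    have *: "?d k < rlen T' k \<and> ?d k \<le> ?d (Suc k) \<and> ?d k \<le> rlen T' (Suc k) \<and>
        Plain (Suc (Suc k)) \<le> T' ! k ! ?d k \<and> (\<forall>c < ?d k. rle (T' ! Suc k ! c) (T' ! k ! ?d k))"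
    proof (cases "k = r")
      case True
      then show ?thesis using d(1) here next_row \<open>Plain _ \<le> _\<close>
          \<open>\<And>c'. c' < c \<Longrightarrow> rle (T' ! Suc r ! c') ?y\<close> by simp
    next
      case False
      then show ?thesis using d(2) k by (simp add: separates_def)
    qed
    from * show "?d k < rlen T' k" by blast
    from * show "?d k \<le> ?d (Suc k)" by blast
    from * show "?d k \<le> rlen T' (Suc k)" by blast
    from * show "Plain (Suc (Suc k)) \<le> T' ! k ! ?d k" by blast
    fix c' assume "c' < ?d k"
    with * show "rle (T' ! Suc k ! c') (T' ! k ! ?d k)" by blast
  qed
  moreover have "c \<le> (d(r := c)) r" by simp
  ultimately show ?case by blast
next
  case (stop T r c)
  have r: "corner T r" using stop(1,2) by (auto simp: corner_def)
  \<comment> \<open>With \<open>s = r\<close> only the value at row \<open>s\<close> matters, and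
    the deleted box was in column \<open>c\<close>.\<close>
  have "separates T' r s (\<lambda>_. c)"
    using stop delete_box_props(1)[OF stop(4) r] by (auto simp: separates_def)
  then show ?case by (intro exI[of _ "\<lambda>_. c"]) simp
qed

text \<open>Just left of the path a right move is ruled out, since the entry below the hole precedes
  the entry on the path; a stop above row \<open>s\<close> is ruled out, since the row below is long
  enough. Agreement with \<open>U\<close> is required only ahead of the hole, as the slide has
  altered what lies behind it.\<close>

lemma slide_below_separating:
  assumes "c < rlen T r" "slide T r c = (T', s')" "rlen T = rlen U" "separates U r0 s d" "r0 \<le> r"
    and "\<forall>k c'. c' < rlen U k \<and> (r < k \<or> k = r \<and> c < c') \<longrightarrow> T ! k ! c' = U ! k ! c'"
    and "r \<le> s \<Longrightarrow> c < d r"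
  shows "s \<le> s'"
  using assms
proof (induction T r c rule: slide_rule)
  case (right T r c)
  note agree = right.prems(5)
  let ?T = "put T r c (T ! r ! Suc c)"
  have sep: "d r \<le> rlen U (Suc r)" "\<forall>c < d r. rle (U ! Suc r ! c) (U ! r ! d r)" if "r < s"
    using right.prems(3,4) that by (auto simp: separates_def)
  show ?case
  proof (rule right.IH)
    show "slide ?T r (Suc c) = (T', s')" using right.prems(1) right(4) by simp
    show "rlen ?T = rlen U" "separates U r0 s d" "r0 \<le> r" using right.prems by simp_all
    show "\<forall>k c'. c' < rlen U k \<and> (r < k \<or> k = r \<and> Suc c < c') \<longrightarrow> ?T ! k ! c' = U ! k ! c'"
      using agree by (auto simp: nth_put[OF right(1)])
    show "Suc c < d r" if "r \<le> s"
    proof (cases "r = s")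
      case True
      then show ?thesis using right(2) right.prems(2,3) by (auto simp: separates_def)
    next
      case False
      then have rs: "r < s" using that by simp
      have c: "c < d r" using right.prems(6)[OF that] .
      have "Suc c \<noteq> d r"
      proof
        assume eq: "Suc c = d r"
        have b: "c < rlen T (Suc r)" using c sep(1)[OF rs] right.prems(2) by simp
        have "T ! Suc r ! c = U ! Suc r ! c" "T ! r ! Suc c = U ! r ! d r"
          using agree b right(2) right.prems(2) by (auto simp flip: eq)
        then show False using right(3)[OF b] sep(2)[OF rs] c by simp
      qed
      with c show ?thesis by simp
    qed
  qed
next
  case (down T r c)
  let ?T = "put T r c (T ! Suc r ! c)"
  show ?case
  proof (rule down.IH)
    show "slide ?T (Suc r) c = (T', s')" using down.prems(1) down(4) by simp
    show "rlen ?T = rlen U" "separates U r0 s d" "r0 \<le> Suc r" using down.prems by simp_all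
    show "\<forall>k c'. c' < rlen U k \<and> (Suc r < k \<or> k = Suc r \<and> c < c') \<longrightarrow> ?T ! k ! c' = U ! k ! c'"
      using down.prems(5) by (auto simp: nth_put[OF down(1)])
    show "c < d (Suc r)" if "Suc r \<le> s"
    proof -
      have "c < d r" using down.prems(6) that by simp
      also have "d r \<le> d (Suc r)" using down.prems(3,4) that by (simp add: separates_def)
      finally show ?thesis .
    qed
  qed
next
  case (stop T r c)
  show ?case
  proof (rule ccontr)
    assume "\<not> s \<le> s'"
    then have rs: "r < s" using stop(3,4) by simp
    then have "c < d r" using stop(9) by simp
    moreover have "d r \<le> rlen U (Suc r)" using stop(6,7) rs by (simp add: separates_def)
    ultimately show False using stop(2,5) by simp
  qed
qed

text \<open>Bumps leave the rows still to be visited untouched, so this reduces to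
  \<open>slide_below_separating\<close> once the cancellation is located to the left of the
  path.\<close>

lemma insert_below_separating:
  assumes "insert_from T r z = (T', Removed s')" "rlen T = rlen U" "tab rle A {} U"
    and "separates U r0 s d" "r0 \<le> r"
    and "\<forall>k c. c < rlen U k \<and> r \<le> k \<longrightarrow> T ! k ! c = U ! k ! c"
  shows "s \<le> s'"
  using assms
proof (induction T r z rule: insert_rule)
  case (add T r z)
  then show ?case by simp
next
  case (cancel T r z c)
  have sl: "slide T r c = (T', s')" using cancel(5) cancel.prems(1) by (auto simp: prod_eq_iff)
  show ?case
  proof (rule slide_below_separating[OF cancel(1) sl cancel.prems(2,4,5)])
    show "\<forall>k c'. c' < rlen U k \<and> (r < k \<or> k = r \<and> c < c') \<longrightarrow> T ! k ! c' = U ! k ! c'"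
      using cancel.prems(6) by auto
    show "c < d r" if "r \<le> s"
    proof (cases "r = s")
      case True
      then show ?thesis using cancel(1) cancel.prems(2,4) by (auto simp: separates_def)
    next
      case False
      then have sep: "d r < rlen U r" "Plain (Suc (Suc r)) \<le> U ! r ! d r"
        using cancel.prems(4,5) that by (auto simp: separates_def)
      have c: "c < rlen U r" "U ! r ! c = Barred (Suc r)"
        using cancel.prems(2,6) cancel(1,3) by auto
      \<comment> \<open>The entry on the path exceeds the cancelled letter, so the latter stands
        further left in the row.\<close>
      have "Barred (Suc r) < U ! r ! d r"
        using sep(2) by (cases "U ! r ! d r") (auto simp: less_letter_def less_eq_letter_def)
      then have "c \<noteq> d r" "\<not> rle (U ! r ! d r) (U ! r ! c)"
        using c by (auto simp: rle_def)
      then show ?thesis using tab_row[OF cancel.prems(3) _ c(1), of "d r"] by fastforce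
    qed
  qed
next
  case (bump T r z c)
  show ?case
  proof (rule bump.IH)
    show "insert_from (put T r c z) (Suc r) (T ! r ! c) = (T', Removed s')"
      using bump(5) bump.prems(1) by simp
    show "\<forall>k c'. c' < rlen U k \<and> Suc r \<le> k \<longrightarrow> put T r c z ! k ! c' = U ! k ! c'"
      using bump.prems(6) by (auto simp: nth_put[OF bump(1)])
  qed (use bump.prems in simp_all)
qed

text \<open>Here \<open>V\<close> is \<open>U\<close> up to changes in the rows above
  \<open>r\<close>, where the second insertion has already acted. The induction follows the first
  route: whenever both insertions bump in row \<open>r\<close>, the two bumped entries are again
  related by \<open>rle\<close>.\<close>

lemma insert_compare:
  assumes "insertable (spo_row m n) T r z" "insert_from T r z = (U, ch)"
    and "rlen V = rlen U" "\<forall>k c. c < rlen U k \<and> r \<le> k \<longrightarrow> V ! k ! c = U ! k ! c"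
    and "rle z z'" "insert_from V r z' = (V', ch')"
  shows "case ch of Added s \<Rightarrow> \<exists>s' \<le> s. ch' = Added s' | Removed s \<Rightarrow> \<forall>s'. ch' = Removed s' \<longrightarrow> s \<le> s'"
  using assms
proof (induction T r z arbitrary: V z' rule: insert_rule)
  case (add T r z)
  have "addable T r"
    using insertable_above[OF add.prems(1) order_refl add(1)] by (auto simp: addable_def)
  note add_box = nth_add_box[OF addable_le_length[OF this], of _ z]
    rlen_add_box[OF addable_le_length[OF this], of z]
  have U: "U = add_box T r z" "ch = Added r" using add by simp_all
  \<comment> \<open>Row \<open>r\<close> of \<open>V\<close> is the old row with \<open>z\<close>
    appended, so \<open>z'\<close> may follow all of it.\<close>
  have "rle (V ! r ! c) z'" if "c < rlen V r" for c
  proof (cases "c = rlen T r")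
    case True
    then show ?thesis using that add.prems by (simp add: U add_box)
  next
    case False
    then have "rle (V ! r ! c) z" using that add(1) add.prems(3,4) by (simp add: U add_box)
    then show ?thesis using add.prems(5) rle_trans by blast
  qed
  then have V: "\<forall>c < rlen V r. rle (V ! r ! c) z'" by blast
  show ?case
  proof (cases rule: insert_cases[where T = V and r = r and z = z'])
    case add
    then show ?thesis using add.prems U \<open>insert_from V r z' = (V', ch')\<close> by simp
  next
    case (cancel c)
    then show ?thesis using V by (auto simp: rle_def less_letter_def less_eq_letter_def)
  qed (use V in blast)
next
  case (cancel T r z c)
  have T: "tab rle (spo_row m n) {(r, c)} T"
    using cancel.prems(1) by (auto simp: insertable_def intro: tab_hole[rotated])
  have sl: "slide T r c = (U, snd (slide T r c))" and ch: "ch = Removed (snd (slide T r c))"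
    using cancel(5) cancel.prems(2) by (auto simp: prod_eq_iff)
  obtain d where d: "separates U r (snd (slide T r c)) d"
    using slide_separates[OF cancel(1) T sl] by blast
  have U: "tab rle (spo_row m n) {} U"
    using slide_tab[OF cancel(1) T spo_row_Suc sl] by blast
  show ?case
    using insert_below_separating[OF _ cancel.prems(3) U d order_refl cancel.prems(4)] cancel.prems(6)
    by (auto simp: ch)
next
  case (bump T r z c)
  let ?x = "T ! r ! c"
  have T: "tab rle (spo_row m n) {} T" and z: "z \<in> spo_row m n r"
    using bump.prems(1) by (simp_all add: insertable_def)
  have I: "insertable (spo_row m n) (put T r c z) (Suc r) ?x"
    using bump.prems(1) bump(1-4) by (rule insertable_bump)
  have eq: "insert_from (put T r c z) (Suc r) ?x = (U, ch)" using bump(5) bump.prems(2) by simp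
  have res: "Suc r \<le> change_row ch" "changed T ch (rlen U)"
    "\<And>c'. c' < rlen U r \<Longrightarrow> U ! r ! c' = put T r c z ! r ! c'"
    using insert_from_tab[OF I eq] by auto
  have len: "rlen V r = rlen T r"
    using res(1,2) bump.prems(3) by (auto simp: changed_def split: change.splits)
  have V: "V ! r ! c' = (if c' = c then z else T ! r ! c')" if "c' < rlen V r" for c'
    using that bump.prems(3,4) res(3)[of c'] by (simp add: nth_put[OF bump(1)])
  \<comment> \<open>Columns up to \<open>c\<close> hold \<open>z\<close> or entries preceding it,
    hence entries preceding \<open>z'\<close>; the second route can only act further right.\<close>
  have gt: "c < c'" if "c' < rlen V r" "\<not> rle (V ! r ! c') z'" for c'
  proof (rule ccontr)
    assume "\<not> c < c'"
    then have "c' = c \<or> rle (V ! r ! c') z" using V[OF that(1)] bump(3) by auto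
    moreover have "V ! r ! c' = z" if "c' = c" using V[OF \<open>c' < rlen V r\<close>] that by simp
    ultimately show False using that(2) bump.prems(5) rle_trans by metis
  qed
  show ?case
  proof (cases rule: insert_cases[where T = V and r = r and z = z'])
    case add
    then have "ch' = Added r" using bump.prems(6) by simp
    then show ?thesis using res(1) by (cases ch) auto
  next
    \<comment> \<open>The row bound and \<open>z'\<close> force \<open>z\<close> to be
      \<open>Plain (Suc r)\<close>, and the entry that \<open>z\<close> bumps is then forced to be
      \<open>Barred (Suc r)\<close>, so the first insertion would have cancelled in this
      row.\<close>
    case (cancel c')
    have "\<not> rle (V ! r ! c') z'" by (simp add: cancel(2,3) rle_def less_letter_def less_eq_letter_def)
    then have c': "c < c'" using gt cancel(1) by blast
    then have "rle ?x (Barred (Suc r))"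
      using tab_row[OF T c'] V[OF cancel(1)] cancel(1,3) len by simp
    moreover have "z = Plain (Suc r)"
      using z bump.prems(5) cancel(2) by (auto simp: spo_row_def rle_def)
    ultimately have "?x = Barred (Suc r)"
      using bump(2) by (cases ?x) (auto simp: rle_def less_letter_def less_eq_letter_def)
    then show ?thesis using bump(4) \<open>z = Plain (Suc r)\<close> by blast
  next
    case b: (bump c')
    have c': "c < c'" using gt b(1,2) by blast
    then have Vc': "V ! r ! c' = T ! r ! c'" using V[OF b(1)] by simp
    show ?thesis
    proof (rule bump.IH[OF I eq])
      show "rlen (put V r c' z') = rlen U" using bump.prems(3) by simp
      show "\<forall>k d. d < rlen U k \<and> Suc r \<le> k \<longrightarrow> put V r c' z' ! k ! d = U ! k ! d"
        using bump.prems(4) by (auto simp: nth_put[OF b(1)])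
      show "rle ?x (V ! r ! c')" using tab_row[OF T c'] b(1) len Vc' by simp
      show "insert_from (put V r c' z') (Suc r) (V ! r ! c') = (V', ch')"
        using b(5) bump.prems(6) by simp
    qed
  qed
qed

section \<open>Reverse column insertion\<close>

text \<open>The analogue of \<open>insertable\<close> for columns: \<open>x\<close> has left column
  \<open>c\<close> from row \<open>r0\<close>. The entry to its left supplies a candidate for the
  next bump, and the entries of column \<open>c\<close> from row \<open>r0\<close> on leave room for
  \<open>x\<close> to their left.\<close>

definition rev_bumpable :: "nat set \<Rightarrow> nat tableau \<Rightarrow> nat \<Rightarrow> nat \<Rightarrow> bool" where
  "rev_bumpable S P c x \<longleftrightarrow> tab (\<le>) (\<lambda>_. S) {} P \<and> x \<in> S \<and>
     (\<exists>r0. (\<forall>k. c = Suc k \<longrightarrow> k < rlen P r0 \<and> P ! r0 ! k \<le> x) \<and>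
       (\<forall>r \<ge> r0. c < rlen P r \<longrightarrow> x \<le> P ! r ! c))"

text \<open>Strictness of column \<open>c\<close> puts its largest entry not exceeding
  \<open>x\<close> weakly below \<open>r0\<close>, where any right neighbour is at least
  \<open>x\<close>; everything further down in column \<open>c\<close> exceeds \<open>x\<close>. So
  the replacement keeps rows and columns ordered.\<close>

lemma rev_bump_step:
  assumes "rev_bumpable S P (Suc c) x"
  obtains r where "c < rlen P r" "P ! r ! c \<le> x"
    "\<And>k. c < rlen P k \<Longrightarrow> P ! k ! c \<le> x \<Longrightarrow> P ! k ! c \<le> P ! r ! c"
    "rev_bump P (Suc c) x = rev_bump (put P r c x) c (P ! r ! c)"
    "rev_bumpable S (put P r c x) c (P ! r ! c)"
proof -
  have T: "tab (\<le>) (\<lambda>_. S) {} P" and x: "x \<in> S" using assms by (simp_all add: rev_bumpable_def)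
  obtain r0 where r0: "c < rlen P r0" "P ! r0 ! c \<le> x"
    "\<And>r. r0 \<le> r \<Longrightarrow> Suc c < rlen P r \<Longrightarrow> x \<le> P ! r ! Suc c"
    using assms by (auto simp: rev_bumpable_def)
  define M where "M = {P ! r ! c | r. r < length P \<and> c < length (P ! r) \<and> P ! r ! c \<le> x}"
  define y where "y = Max M"
  have M: "z \<in> M \<longleftrightarrow> (\<exists>r. z = P ! r ! c \<and> c < rlen P r \<and> P ! r ! c \<le> x)" for z
    unfolding M_def rlen_def by auto
  have "M \<subseteq> {..x}" using M by auto
  then have fin: "finite M" using finite_subset by blast
  have "P ! r0 ! c \<in> M" using M r0(1,2) by blast
  then have yM: "y \<in> M" unfolding y_def by (intro Max_in[OF fin]) auto
  then have ex: "\<exists>r. r < length P \<and> c < length (P ! r) \<and> P ! r ! c = y"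
    unfolding M_def by blast
  define r where "r = (LEAST r. r < length P \<and> c < length (P ! r) \<and> P ! r ! c = y)"
  have r: "c < rlen P r" "P ! r ! c = y"
    using LeastI_ex[OF ex] unfolding r_def[symmetric] rlen_def by simp_all
  have le: "P ! r ! c \<le> x" using yM M r(2) by metis
  have max: "P ! k ! c \<le> P ! r ! c" if "c < rlen P k" "P ! k ! c \<le> x" for k
  proof -
    have "P ! k ! c \<in> M" using M that by blast
    then show ?thesis unfolding r(2) y_def by (rule Max_ge[OF fin])
  qed
  have r0r: "r0 \<le> r"
    using tab_col[OF T, of r r0 c] max[OF r0(1,2)] r0(1) by force
  have eq: "rev_bump P (Suc c) x = rev_bump (put P r c x) c (P ! r ! c)"
    using r(2) by (simp only: rev_bump.simps Let_def M_def[symmetric] y_def[symmetric] r_def[symmetric])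
  have gt: "x < P ! k ! c" if "r < k" "c < rlen P k" for k
  proof (rule ccontr)
    assume "\<not> x < P ! k ! c"
    then show False using tab_col[OF T that] max[OF that(2)] by simp
  qed
  have "tab (\<le>) (\<lambda>_. S) ({(r, c)} - {(r, c)}) (put P r c x)"
  proof (rule tab_put[OF _ r(1) x])
    show "tab (\<le>) (\<lambda>_. S) {(r, c)} P" by (rule tab_hole[OF T]) simp
    show "P ! r ! c' \<le> x" if "c' < c" for c'
      using tab_row[OF T that r(1)] le by simp
    show "x \<le> P ! r ! c'" if "c < c'" "c' < rlen P r" for c'
    proof -
      have "x \<le> P ! r ! Suc c" using r0(3)[OF r0r] that by simp
      then show ?thesis
        using tab_row[OF T _ that(2), of "Suc c"] that by (cases "c' = Suc c") auto
    qed
    show "\<not> x \<le> P ! k ! c" if "k < r" for k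
      using tab_col[OF T that r(1)] le by simp
    show "\<not> P ! k ! c \<le> x" if "r < k" "c < rlen P k" for k
      using gt[OF that] by simp
  qed
  then have "tab (\<le>) (\<lambda>_. S) {} (put P r c x)" by simp
  moreover have "P ! r ! c \<le> put P r c x ! k ! c" if "r \<le> k" "c < rlen P k" for k
    using gt[of k] that le by (cases "k = r") (auto simp: nth_put[OF r(1)])
  moreover have "k < rlen P r \<and> put P r c x ! r ! k \<le> P ! r ! c" if "c = Suc k" for k
  proof -
    have "put P r c x ! r ! k = P ! r ! k" unfolding nth_put[OF r(1)] using that by simp
    then show ?thesis using tab_row[OF T _ r(1), of k] that r(1) by simp
  qed
  moreover have "P ! r ! c \<in> S" using tab_mem[OF T r(1)] by simp
  ultimately have "rev_bumpable S (put P r c x) c (P ! r ! c)"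
    unfolding rev_bumpable_def rlen_put by blast
  with r(1) le max eq show thesis by (rule that)
qed

text \<open>
  The entry \<open>v (Suc k)\<close> moves into column \<open>k\<close> and bumps \<open>v k\<close>.  Since the final tableau
  still has \<open>v (Suc k)\<close> in column \<open>k\<close>, the next reverse insertion bumps larger entries.
\<close>

definition rev_chain :: "nat tableau \<Rightarrow> nat \<Rightarrow> (nat \<Rightarrow> nat) \<Rightarrow> bool" where
  "rev_chain P c v \<longleftrightarrow>
     (\<forall>k < c. v k \<le> v (Suc k) \<and> (\<exists>r. k < rlen P r \<and> P ! r ! k = v (Suc k)))"

text \<open>Later bumps act only in columns further left, so the value placed in a column survives
  in \<open>P'\<close> and extends the chain.\<close>

lemma rev_bump_tab:
  assumes "rev_bumpable S P c x" "rev_bump P c x = (P', a)"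
  shows "tab (\<le>) (\<lambda>_. S) {} P' \<and> a \<in> S \<and> rlen P' = rlen P \<and>
    (\<forall>r k. c \<le> k \<longrightarrow> P' ! r ! k = P ! r ! k) \<and> (\<exists>v. v 0 = a \<and> v c = x \<and> rev_chain P' c v)"
  using assms
proof (induction c arbitrary: P x)
  case 0
  then show ?case by (auto simp: rev_bumpable_def rev_chain_def)
next
  case (Suc c)
  obtain r where r: "c < rlen P r" "P ! r ! c \<le> x"
    "rev_bump P (Suc c) x = rev_bump (put P r c x) c (P ! r ! c)"
    "rev_bumpable S (put P r c x) c (P ! r ! c)"
    using rev_bump_step[OF Suc.prems(1)] by blast
  have "rev_bump (put P r c x) c (P ! r ! c) = (P', a)" using r(3) Suc.prems(2) by simp
  note IH = Suc.IH[OF r(4) this]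
  then obtain v where v: "v 0 = a" "v c = P ! r ! c" "rev_chain P' c v" by blast
  have len: "rlen P' = rlen P" using IH by simp
  have "P' ! r ! c = x" using IH by (simp add: nth_put[OF r(1)])
  then have "rev_chain P' (Suc c) (v(Suc c := x))"
    using v(2,3) r(1,2) len by (auto simp: rev_chain_def less_Suc_eq)
  moreover have "(v(Suc c := x)) 0 = a" "(v(Suc c := x)) (Suc c) = x" using v(1) by simp_all
  moreover have "P' ! k ! d = P ! k ! d" if "Suc c \<le> d" for k d
    using IH that by (simp add: nth_put[OF r(1)])
  ultimately show ?case using IH len by blast
qed

text \<open>The chain value stored in each column does not exceed the incoming entry, so it competes
  for the maximum and the bumped entry is at least as large. The inequality thus travels left to the
  ejected entries.\<close>

lemma rev_bump_ge_chain:
  assumes "rev_bumpable S P c x" "rev_chain P c v" "v c \<le> x"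
  shows "v 0 \<le> snd (rev_bump P c x)"
  using assms
proof (induction c arbitrary: P x)
  case 0
  then show ?case by simp
next
  case (Suc c)
  obtain r where r: "c < rlen P r"
    "\<And>k. c < rlen P k \<Longrightarrow> P ! k ! c \<le> x \<Longrightarrow> P ! k ! c \<le> P ! r ! c"
    "rev_bump P (Suc c) x = rev_bump (put P r c x) c (P ! r ! c)"
    "rev_bumpable S (put P r c x) c (P ! r ! c)"
    using rev_bump_step[OF Suc.prems(1)] by metis
  obtain k where k: "c < rlen P k" "P ! k ! c = v (Suc c)" "v c \<le> v (Suc c)"
    using Suc.prems(2) by (auto simp: rev_chain_def)
  have "v c \<le> P ! r ! c" using r(2)[OF k(1)] k Suc.prems(3) by simp
  moreover have "rev_chain (put P r c x) c v"
    using Suc.prems(2) by (auto simp: rev_chain_def nth_put[OF r(1)])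
  ultimately show ?case using Suc.IH[OF r(4)] r(3) by simp
qed

text \<open>Once the corner is deleted, its column has no box in row \<open>r\<close> or below, so
  with \<open>r0 = r\<close> the condition on the lower entries is vacuous.\<close>

lemma rev_column_insert_bumpable:
  assumes T: "tab (\<le>) (\<lambda>_. S) {} P" and r: "corner P r"
  shows "rev_bumpable S (delete_box P r) (rlen P r - 1) (P ! r ! (rlen P r - 1))"
    and "rev_column_insert P r = rev_bump (delete_box P r) (rlen P r - 1) (P ! r ! (rlen P r - 1))"
proof -
  note D = delete_box_props[OF T r]
  have pos: "0 < rlen P r" using r by (simp add: corner_def)
  have len: "rlen P r = length (P ! r)" using rlen_pos_imp[OF pos] by (simp add: rlen_def)
  then show "rev_column_insert P r = rev_bump (delete_box P r) (rlen P r - 1) (P ! r ! (rlen P r - 1))"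
    using pos by (simp add: rev_column_insert_def last_conv_nth)
  have D1: "tab (\<le>) (\<lambda>_. S) {} (delete_box P r)" using T r by (rule tab_delete_box) simp
  moreover have "P ! r ! (rlen P r - 1) \<in> S" using tab_mem[OF T, of "rlen P r - 1" r] pos by simp
  moreover have "k < rlen (delete_box P r) r \<and> delete_box P r ! r ! k \<le> P ! r ! (rlen P r - 1)"
    if "rlen P r - 1 = Suc k" for k
    using tab_row[OF T, of k "rlen P r - 1" r] that D(1) D(2)[of k r] pos by simp
  moreover have "\<not> rlen P r - 1 < rlen (delete_box P r) k" if "r \<le> k" for k
    using tab_antimono[OF D1 that] D(1) by simp
  ultimately show "rev_bumpable S (delete_box P r) (rlen P r - 1) (P ! r ! (rlen P r - 1))"
    unfolding rev_bumpable_def by blast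
qed

lemma rev_column_insert_tab:
  assumes T: "tab (\<le>) (\<lambda>_. S) {} P" and r: "corner P r" and eq: "rev_column_insert P r = (P', a)"
  shows "tab (\<le>) (\<lambda>_. S) {} P' \<and> a \<in> S \<and> rlen P' = (rlen P)(r := rlen P r - 1) \<and>
    (\<exists>v. v 0 = a \<and> rev_chain P' (rlen P r - 1) v)"
  using rev_bump_tab[OF rev_column_insert_bumpable(1)[OF T r], of P' a]
    rev_column_insert_bumpable(2)[OF T r] eq delete_box_props(1)[OF T r] by auto

text \<open>A corner weakly below the removed one lies in a column \<open>c\<close> strictly to the
  left of it. The first chain left \<open>v (Suc c)\<close> there, so the second starts with an
  entry at least \<open>v c\<close> and \<open>rev_bump_ge_chain\<close> applies.\<close>

lemma rev_column_insert_mono: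
  assumes T: "tab (\<le>) (\<lambda>_. S) {} P" and r: "corner P r" and eq: "rev_column_insert P r = (P', a)"
    and s: "corner P' s" "r \<le> s"
  shows "a \<le> snd (rev_column_insert P' s)"
proof -
  obtain v where T': "tab (\<le>) (\<lambda>_. S) {} P'" and len: "rlen P' = (rlen P)(r := rlen P r - 1)"
    and v: "v 0 = a" "rev_chain P' (rlen P r - 1) v"
    using rev_column_insert_tab[OF T r eq] by blast
  define c where "c = rlen P' s - 1"
  have cs: "rlen P' s = Suc c" using s(1) by (simp add: corner_def c_def)
  have c: "c < rlen P r - 1"
    using tab_antimono[OF T' s(2)] cs len by simp
  obtain k where k: "c < rlen P' k" "P' ! k ! c = v (Suc c)" "v c \<le> v (Suc c)"
    using v(2) c by (auto simp: rev_chain_def)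
  \<comment> \<open>The corner is the lowest box of column \<open>c\<close>, so the chain value
    stands weakly above it.\<close>
  have "k \<le> s"
  proof (rule ccontr)
    assume "\<not> k \<le> s"
    then have "rlen P' k \<le> rlen P' (Suc s)" using tab_antimono[OF T', of "Suc s" k] by simp
    then show False using k(1) s(1) cs by (simp add: corner_def)
  qed
  then have "P' ! k ! c \<le> P' ! s ! c"
    using tab_col[OF T', of k s c] cs by (cases "k = s") auto
  then have le: "v c \<le> P' ! s ! c" using k by simp
  have "rev_chain (delete_box P' s) c v"
    unfolding rev_chain_def
  proof (intro allI impI conjI)
    fix j assume j: "j < c"
    then show "v j \<le> v (Suc j)" using v(2) c by (simp add: rev_chain_def)
    have "j < rlen P r - 1" using j c by simp
    then obtain l where l: "j < rlen P' l" "P' ! l ! j = v (Suc j)"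
      using v(2) unfolding rev_chain_def by blast
    have "j < rlen (delete_box P' s) l"
      using l(1) j cs by (simp add: delete_box_props(1)[OF T' s(1)])
    moreover from this have "delete_box P' s ! l ! j = v (Suc j)"
      using l(2) delete_box_props(2)[OF T' s(1)] by simp
    ultimately show "\<exists>r. j < rlen (delete_box P' s) r \<and> delete_box P' s ! r ! j = v (Suc j)"
      by blast
  qed
  then show ?thesis
    using rev_bump_ge_chain[OF rev_column_insert_bumpable(1)[OF T' s(1)], of v]
      rev_column_insert_bumpable(2)[OF T' s(1)] le v(1) by (simp add: c_def)
qed

section \<open>Recovering the global definitions\<close>

lemma antimono_diagram:
  assumes anti: "\<And>k. g (Suc k) \<le> g k" and zero: "g N = 0"
  obtains mu where "partition_shape mu" "diagram mu = {(r, c). c < g r}"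
proof
  define l where "l = (LEAST k. g k = 0)"
  have l: "g l = 0" unfolding l_def using zero by (rule LeastI)
  have pos: "0 < g k" if "k < l" for k
    using not_less_Least[of k "\<lambda>k. g k = 0"] that by (simp add: l_def)
  have mono: "g k' \<le> g k" if "k \<le> k'" for k k'
    using lift_Suc_antimono_le[of g] anti that by blast
  show "partition_shape (map g [0..<l])"
    unfolding partition_shape_def
  proof
    show "sorted_wrt (\<ge>) (map g [0..<l])" using mono by (auto simp: sorted_wrt_iff_nth_less)
    show "0 \<notin> set (map g [0..<l])" using pos by fastforce
  qed
  have "c < g r \<Longrightarrow> r < l" for r c
    using mono[of l r] l by (cases "r < l") auto
  then show "diagram (map g [0..<l]) = {(r, c). c < g r}"
    by (auto simp: diagram_def)
qed

lemma diagram_shape: "diagram (shape T) = {(r, c). c < rlen T r}"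
  by (auto simp: diagram_def shape_def rlen_def split: if_splits)

lemma tab_partition_shape: "tab le A H T \<Longrightarrow> partition_shape (shape T)"
proof -
  assume T: "tab le A H T"
  have "length (T ! r') \<le> length (T ! r)" if "r < r'" "r' < length T" for r r'
    using tab_antimono[OF T, of r r'] that by (simp add: rlen_def)
  moreover have "T ! r \<noteq> []" if "r < length T" for r
    using tab_length_iff[OF T, of r] that by (auto simp: rlen_def)
  ultimately show ?thesis
    by (auto simp: partition_shape_def shape_def sorted_wrt_iff_nth_less in_set_conv_nth)
qed

lemma tab_entries:
  assumes T: "tab le A {} T" and A: "\<And>r. A r \<subseteq> S"
  shows "entries T \<subseteq> S"
proof
  fix x assume "x \<in> entries T"
  then obtain r c where "r < length T" "c < length (T ! r)" "x = T ! r ! c"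
    by (auto simp: entries_def in_set_conv_nth)
  then have "c < rlen T r" "x = T ! r ! c" by (simp_all add: rlen_def)
  then show "x \<in> S" using tab_mem[OF T, of c r] A by auto
qed

lemma tab_semistandard:
  assumes T: "tab (\<le>) A {} (P :: 'a::linorder tableau)"
  shows "semistandard (shape P) P"
  unfolding semistandard_def rows_weak_def cols_strict_def diagram_shape
  using tab_partition_shape[OF T] tab_row[OF T] tab_col[OF T] by (auto simp: not_le)

text \<open>Letters of \<open>B1\<close> exceed those of \<open>B0\<close>, so the boxes with
  letters of \<open>B0\<close> are closed to the left and upwards; \<open>g\<close> counts them row
  by row and yields \<open>mu\<close>. On each alphabet, \<open>rle\<close> and its reversed
  negation become the required weak and strict orders.\<close>

lemma tab_spo_tableau:
  assumes T: "tab rle (spo_row m n) {} T"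
  shows "spo_tableau m n (shape T) T"
proof -
  define g where "g r = length (takeWhile in_B0 (if r < length T then T ! r else []))" for r
  have Circled: "rle x y \<or> \<not> rle y x \<Longrightarrow> in_B0 y \<Longrightarrow> in_B0 x" for x y
    by (cases x; cases y) (auto simp: rle_def less_letter_def less_eq_letter_def)
  have g: "c < g r \<longleftrightarrow> c < rlen T r \<and> in_B0 (T ! r ! c)" for r c
  proof (cases "r < length T")
    case True
    have len: "g r \<le> rlen T r" using True by (simp add: g_def rlen_def length_takeWhile_le)
    have nth: "in_B0 (T ! r ! c)" if "c < g r" for c
    proof -
      have "c < length (takeWhile in_B0 (T ! r))" using that True by (simp add: g_def)
      then show ?thesis using nth_mem set_takeWhileD takeWhile_nth by metis
    qed
    have stop: "\<not> in_B0 (T ! r ! g r)" if "g r < rlen T r"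
      using that True nth_length_takeWhile[of in_B0 "T ! r"] by (simp add: g_def rlen_def)
    have "\<not> in_B0 (T ! r ! c)" if "g r \<le> c" "c < rlen T r" for c
    proof (cases "g r = c")
      case False
      then have "rle (T ! r ! g r) (T ! r ! c)" using tab_row[OF T _ that(2), of "g r"] that by simp
      then show ?thesis using stop that Circled by (meson le_less_trans)
    qed (use stop that in auto)
    then show ?thesis using len nth by (meson leI order_less_le_trans)
  qed (simp add: g_def rlen_def)
  have "g (Suc r) \<le> g r" for r
  proof (rule ccontr)
    assume *: "\<not> g (Suc r) \<le> g r"
    then have "g r < rlen T (Suc r)" "in_B0 (T ! Suc r ! g r)"
      using g[of "g r" "Suc r"] by auto
    moreover from this have "in_B0 (T ! r ! g r)" "g r < rlen T r"
      using Circled tab_col[OF T, of r "Suc r" "g r"] tab_antimono[OF T, of r "Suc r"] by auto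
    ultimately show False using g[of "g r" r] by simp
  qed
  moreover have "g (length T) = 0" by (simp add: g_def)
  ultimately obtain mu where mu: "partition_shape mu" "diagram mu = {(r, c). c < g r}"
    by (rule antimono_diagram)
  have mem: "T ! r ! c \<in> B0 m \<union> B1 n" "Plain (Suc r) \<le> T ! r ! c" if "c < rlen T r" for r c
    using tab_mem[OF T that] by (simp_all add: spo_row_def)
  have B0: "x \<in> B0 m \<longleftrightarrow> in_B0 x" if "x \<in> B0 m \<union> B1 n" for x
    using that by (auto simp: B0_def B1_def)
  have "{(r, c) \<in> diagram (shape T). T ! r ! c \<in> B0 m} = diagram mu"
    using B0[OF mem(1)] by (auto simp: diagram_shape mu(2) g)
  moreover have "rows_weak (diagram mu) T"
    using tab_row[OF T] by (fastforce simp: rows_weak_def mu(2) g rle_def)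
  moreover have "cols_strict (diagram mu) T"
    using tab_col[OF T] by (fastforce simp: cols_strict_def mu(2) g not_rle)
  moreover have "\<forall>(r, c) \<in> diagram mu. Plain (Suc r) \<le> T ! r ! c"
    using mem(2) by (auto simp: mu(2) g)
  moreover have "rows_strict (diagram (shape T) - diagram mu) T"
    using tab_row[OF T] by (fastforce simp: rows_strict_def diagram_shape mu(2) g rle_def)
  moreover have "cols_weak (diagram (shape T) - diagram mu) T"
    using tab_col[OF T] by (fastforce simp: cols_weak_def diagram_shape mu(2) g not_rle)
  moreover have "entries T \<subseteq> B0 m \<union> B1 n"
    using T by (rule tab_entries) (auto simp: spo_row_def)
  ultimately show ?thesis
    using tab_partition_shape[OF T] mu(1) unfolding spo_tableau_def by blast
qed

section \<open>The correspondence\<close>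

text \<open>What must hold before \<open>(i, j)\<close> is processed. An added box gets column
  \<open>rlen P s\<close>, and every \<open>i\<close> already in \<open>P\<close> lies further left,
  which keeps columns strict. For a removal, \<open>P\<close> has no \<open>i\<close> yet, so the
  ejected entry is smaller than \<open>i\<close>; the clause on \<open>last L\<close> keeps
  \<open>L\<close> ordered.\<close>

definition spo_ready ::
  "nat \<Rightarrow> nat \<Rightarrow> nat \<Rightarrow> nat \<Rightarrow> letter \<Rightarrow> letter tableau \<Rightarrow> nat tableau \<Rightarrow> (nat \<times> nat) list \<Rightarrow> bool" where
  "spo_ready m n q i j Pt P L \<longleftrightarrow>
     tab rle (spo_row m n) {} Pt \<and> tab (\<le>) (\<lambda>_. {1..i}) {} P \<and> rlen P = rlen Pt \<and> burge_array q L \<and>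
     i \<in> {1..q} \<and> j \<in> spo_row m n 0 \<and> (\<forall>V ch. spo_insert Pt j = (V, ch) \<longrightarrow> (case ch of
        Added s \<Rightarrow> \<forall>r c. c < rlen P r \<and> P ! r ! c = i \<longrightarrow> c < rlen P s
      | Removed s \<Rightarrow> tab (\<le>) (\<lambda>_. {1..<i}) {} P \<and>
          (L \<noteq> [] \<longrightarrow> fst (last L) \<le> i \<and>
             (fst (last L) = i \<longrightarrow> snd (last L) \<le> snd (rev_column_insert P s)))))"

text \<open>
  Here \<open>ch\<close> is the change made by the column \<open>(i, j)\<close> itself.  It constrains the following columns
  \<open>(i, j')\<close> with the same \<open>i\<close>: after an addition only additions follow, further and further to
  the right, so that the boxes containing \<open>i\<close> form a horizontal strip; hence all removals for \<open>i\<close>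
  precede the first \<open>i\<close> in \<open>P\<close>, and these move downwards.
\<close>

definition spo_done ::
  "nat \<Rightarrow> nat \<Rightarrow> nat \<Rightarrow> nat \<Rightarrow> letter \<Rightarrow> letter tableau \<Rightarrow> nat tableau \<Rightarrow> (nat \<times> nat) list \<Rightarrow> bool" where
  "spo_done m n q i j Pt P L \<longleftrightarrow>
     tab rle (spo_row m n) {} Pt \<and> tab (\<le>) (\<lambda>_. {1..i}) {} P \<and> rlen P = rlen Pt \<and> burge_array q L \<and>
     i \<le> q \<and> (L \<noteq> [] \<longrightarrow> fst (last L) \<le> i) \<and> (\<exists>ch.
       (\<forall>j' V ch'. rle j j' \<and> spo_insert Pt j' = (V, ch') \<longrightarrow> (case ch of
          Added s \<Rightarrow> \<exists>s' \<le> s. ch' = Added s'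
        | Removed s \<Rightarrow> \<forall>s'. ch' = Removed s' \<longrightarrow> s \<le> s')) \<and>
       (case ch of
          Added s \<Rightarrow> \<forall>r c. c < rlen P r \<and> P ! r ! c = i \<longrightarrow> c < rlen P s
        | Removed s \<Rightarrow> tab (\<le>) (\<lambda>_. {1..<i}) {} P \<and>
            (\<forall>s'. corner P s' \<and> s \<le> s' \<longrightarrow> snd (last L) \<le> snd (rev_column_insert P s'))))"

section \<open>Two-line arrays and single steps of the correspondence\<close>

lemma two_line_ordered_snoc:
  "two_line_ordered (w @ [x]) \<longleftrightarrow> two_line_ordered w \<and>
     (w = [] \<or> fst (last w) \<le> fst x \<and> (fst (last w) = fst x \<longrightarrow> snd (last w) \<le> snd x))"
proof (cases w rule: rev_cases)
  case Nil
  then show ?thesis by (simp add: two_line_ordered_def)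
next
  case (snoc u y)
  have "(\<forall>k. Suc k < length (w @ [x]) \<longrightarrow> Q ((w @ [x]) ! k) ((w @ [x]) ! Suc k)) \<longleftrightarrow>
      (\<forall>k. Suc k < length w \<longrightarrow> Q (w ! k) (w ! Suc k)) \<and> Q y x" for Q
    by (auto simp: snoc nth_append less_Suc_eq)
  from this[of "\<lambda>p q. fst p \<le> fst q \<and> (fst p = fst q \<longrightarrow> snd p \<le> snd q)"]
  show ?thesis by (simp add: two_line_ordered_def snoc)
qed

lemma burge_array_snoc:
  assumes "burge_array q L" "i \<in> {1..q}" "a \<in> {1..<i}"
    "L \<noteq> [] \<longrightarrow> fst (last L) \<le> i \<and> (fst (last L) = i \<longrightarrow> snd (last L) \<le> a)"
  shows "burge_array q (L @ [(i, a)])"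
proof -
  have "two_line_ordered (L @ [(i, a)])"
    using assms(1,4) unfolding two_line_ordered_snoc burge_array_def by (simp only: fst_conv snd_conv) blast
  moreover have "(i, a) \<in> {1..q} \<times> {1..q - 1}" using assms(2,3) by auto
  moreover have "a < i" using assms(3) by simp
  ultimately show ?thesis using assms(1) by (simp add: burge_array_def)
qed

text \<open>The change made by this column is the witness in \<open>spo_done\<close>;
  \<open>insert_compare\<close> controls its effect on the next insertion,
  \<open>rev_column_insert_mono\<close> that on the next ejected entry.\<close>

lemma spo_step_done:
  assumes R: "spo_ready m n q i j Pt P L" and step: "spo_step (Pt, P, L) (i, j) = (Pt', P', L')"
    and last: "L \<noteq> [] \<longrightarrow> fst (last L) \<le> i"
  shows "spo_done m n q i j Pt' P' L'"
proof -
  have Pt: "tab rle (spo_row m n) {} Pt" and P: "tab (\<le>) (\<lambda>_. {1..i}) {} P"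
    and len: "rlen P = rlen Pt" and L: "burge_array q L" and i: "i \<in> {1..q}"
    and j: "j \<in> spo_row m n 0"
    using R by (simp_all add: spo_ready_def)
  obtain V ch where V: "spo_insert Pt j = (V, ch)" by fastforce
  then have V': "insert_from Pt 0 j = (V, ch)" by (simp add: spo_insert_def)
  have I: "insertable (spo_row m n) Pt 0 j" using Pt j by (simp add: insertable_def)
  have T: "tab rle (spo_row m n) {} V" and ch: "changed Pt ch (rlen V)"
    using insert_from_tab[OF I V'] by auto
  have cmp: "\<forall>j' W ch'. rle j j' \<and> spo_insert V j' = (W, ch') \<longrightarrow> (case ch of
      Added s \<Rightarrow> \<exists>s' \<le> s. ch' = Added s'
    | Removed s \<Rightarrow> \<forall>s'. ch' = Removed s' \<longrightarrow> s \<le> s')"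
    using insert_compare[OF I V' refl] unfolding spo_insert_def by blast
  show ?thesis
  proof (cases ch)
    case (Added s)
    have eq: "Pt' = V" "P' = add_box P s i" "L' = L" using step V Added by simp_all
    have s: "addable P s" using ch len by (simp add: Added changed_def addable_def)
    have icol: "c < rlen P s" if "c < rlen P r" "P ! r ! c = i" for r c
      using R V that by (auto simp: spo_ready_def Added)
    note sl = addable_le_length[OF s]
    have "tab (\<le>) (\<lambda>_. {1..i}) {} P'"
      unfolding eq
    proof (rule tab_add_box[OF P s])
      show "i \<in> {1..i}" using i by simp
      show "P ! s ! c \<le> i" if "c < rlen P s" for c using tab_mem[OF P that] by simp
      \<comment> \<open>All older \<open>i\<close> lie in columns before \<open>rlen P s\<close>, so
        the entries above the new box are smaller than \<open>i\<close>.\<close>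
      show "\<not> i \<le> P ! k ! rlen P s" if "k < s" for k
      proof -
        obtain l where l: "s = Suc l" using \<open>k < s\<close> by (cases s) auto
        have "rlen P s < rlen P k"
          using s tab_antimono[OF P, of k l] that l by (auto simp: addable_def)
        then show ?thesis using tab_mem[OF P, of "rlen P s" k] icol[of "rlen P s" k] by fastforce
      qed
    qed
    moreover have "rlen P' = rlen Pt'"
      using ch len by (simp add: eq Added changed_def rlen_add_box[OF sl])
    moreover have "c < rlen P' s" if "c < rlen P' r" "P' ! r ! c = i" for r c
      using that icol[of c r] nth_add_box[OF sl, of c i r]
      by (auto simp: eq rlen_add_box[OF sl] less_Suc_eq split: if_splits)
    ultimately show ?thesis
      using T L i last cmp unfolding spo_done_def eq
      by (intro conjI exI[of _ ch]) (auto simp: Added)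
  next
    case (Removed s)
    obtain a where a: "rev_column_insert P s = (P', a)" and eq: "Pt' = V" "L' = L @ [(i, a)]"
      using step V Removed by (auto split: prod.splits)
    have s: "corner P s" using ch len by (simp add: Removed changed_def corner_def)
    have Pi: "tab (\<le>) (\<lambda>_. {1..<i}) {} P"
      and Ll: "L \<noteq> [] \<longrightarrow> fst (last L) \<le> i \<and> (fst (last L) = i \<longrightarrow> snd (last L) \<le> a)"
      using R V a by (simp_all add: spo_ready_def Removed)
    have P': "tab (\<le>) (\<lambda>_. {1..<i}) {} P'" "a \<in> {1..<i}" "rlen P' = (rlen P)(s := rlen P s - 1)"
      using rev_column_insert_tab[OF Pi s a] by blast+
    have "tab (\<le>) (\<lambda>_. {1..i}) {} P'" using P'(1) by (rule tab_mono) auto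
    moreover have "rlen P' = rlen Pt'" using P'(3) ch len by (simp add: eq Removed changed_def)
    moreover have "burge_array q L'" unfolding eq using L i P'(2) Ll by (rule burge_array_snoc)
    moreover have "\<forall>s'. corner P' s' \<and> s \<le> s' \<longrightarrow> snd (List.last L') \<le> snd (rev_column_insert P' s')"
      using rev_column_insert_mono[OF Pi s a] by (simp add: eq)
    ultimately show ?thesis
      using T i P'(1) cmp unfolding spo_done_def
      by (intro conjI exI[of _ ch]) (auto simp: Removed eq)
  qed
qed

text \<open>A larger top entry makes the conditions immediate, as \<open>P\<close> has entries up to
  \<open>i\<close> only. For equal tops, an added box is followed by one in a weakly higher, hence
  weakly longer row; after a removal, \<open>P\<close> contains no \<open>i\<close> and the next
  removed corner lies weakly below.\<close>

lemma spo_done_ready: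
  assumes D: "spo_done m n q i j Pt P L"
    and i': "i < i' \<or> i = i' \<and> rle j j'" "i' \<in> {1..q}" and j': "j' \<in> spo_row m n 0"
  shows "spo_ready m n q i' j' Pt P L"
proof -
  have Pt: "tab rle (spo_row m n) {} Pt" and P: "tab (\<le>) (\<lambda>_. {1..i}) {} P"
    and len: "rlen P = rlen Pt" and L: "burge_array q L" "L \<noteq> [] \<longrightarrow> fst (last L) \<le> i"
    using D by (simp_all add: spo_done_def)
  obtain ch where ch: "\<forall>j' V ch'. rle j j' \<and> spo_insert Pt j' = (V, ch') \<longrightarrow> (case ch of
          Added s \<Rightarrow> \<exists>s' \<le> s. ch' = Added s'
        | Removed s \<Rightarrow> \<forall>s'. ch' = Removed s' \<longrightarrow> s \<le> s')"
    "case ch of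
          Added s \<Rightarrow> \<forall>r c. c < rlen P r \<and> P ! r ! c = i \<longrightarrow> c < rlen P s
        | Removed s \<Rightarrow> tab (\<le>) (\<lambda>_. {1..<i}) {} P \<and>
            (\<forall>s'. corner P s' \<and> s \<le> s' \<longrightarrow> snd (last L) \<le> snd (rev_column_insert P s'))"
    using D unfolding spo_done_def by blast
  have I: "insertable (spo_row m n) Pt 0 j'" using Pt j' by (simp add: insertable_def)
  have main: "case ch' of
        Added s \<Rightarrow> \<forall>r c. c < rlen P r \<and> P ! r ! c = i' \<longrightarrow> c < rlen P s
      | Removed s \<Rightarrow> tab (\<le>) (\<lambda>_. {1..<i'}) {} P \<and>
          (L \<noteq> [] \<longrightarrow> fst (last L) \<le> i' \<and>
             (fst (last L) = i' \<longrightarrow> snd (last L) \<le> snd (rev_column_insert P s)))"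
    if V: "spo_insert Pt j' = (V, ch')" for V ch'
  proof (cases "i < i'")
    case True
    have "tab (\<le>) (\<lambda>_. {1..<i'}) {} P" using P by (rule tab_mono) (use True in auto)
    moreover have "P ! r ! c \<noteq> i'" if "c < rlen P r" for r c
      using tab_mem[OF P that] True by simp
    ultimately show ?thesis using L(2) True by (auto split: change.split)
  next
    case False
    then have eq: "i' = i" and jj: "rle j j'" using i'(1) by auto
    have changed: "changed Pt ch' (rlen V)"
      using insert_from_tab[OF I, of V ch'] V by (simp add: spo_insert_def)
    have cmp: "case ch of
          Added s \<Rightarrow> \<exists>s' \<le> s. ch' = Added s'
        | Removed s \<Rightarrow> \<forall>s'. ch' = Removed s' \<longrightarrow> s \<le> s'"
      using ch(1) jj V by blast
    show ?thesis
    proof (cases ch)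
      case (Added s)
      then obtain s' where s': "s' \<le> s" "ch' = Added s'" using cmp by auto
      then have "rlen P s \<le> rlen P s'" using tab_antimono[OF P] by simp
      then show ?thesis using ch(2) s' by (fastforce simp: Added eq)
    next
      case (Removed s)
      then have Pi: "tab (\<le>) (\<lambda>_. {1..<i}) {} P"
        and mono: "\<And>s'. corner P s' \<Longrightarrow> s \<le> s' \<Longrightarrow> snd (last L) \<le> snd (rev_column_insert P s')"
        using ch(2) by simp_all
      have "P ! r ! c \<noteq> i" if "c < rlen P r" for r c
        using tab_mem[OF Pi that] by simp
      moreover have "corner P s'" "s \<le> s'" if "ch' = Removed s'" for s'
        using changed cmp that len by (auto simp: Removed changed_def corner_def)
      ultimately show ?thesis using Pi L(2) mono by (auto simp: eq split: change.split)
    qed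
  qed
  have "tab (\<le>) (\<lambda>_. {1..i'}) {} P" using P by (rule tab_mono) (use i' in auto)
  with main Pt len L(1) i'(2) j' show ?thesis unfolding spo_ready_def by blast
qed

text \<open>The multiplicity bound enters here: a column repeated at the end must have its lower
  letter in \<open>B0\<close>, so neighbouring lower letters under equal tops are related by
  \<open>rle\<close> and not merely by \<open>\<le>\<close>.\<close>

lemma two_line_arrays_snoc:
  assumes "w @ [(i, j)] \<in> two_line_arrays m n q"
  shows "w \<in> two_line_arrays m n q" "i \<in> {1..q}" "j \<in> spo_row m n 0"
    and "w \<noteq> [] \<Longrightarrow> fst (last w) < i \<or> fst (last w) = i \<and> rle (snd (last w)) j"
proof -
  have set: "set w \<subseteq> {1..q} \<times> (B0 m \<union> B1 n)" "(i, j) \<in> {1..q} \<times> (B0 m \<union> B1 n)"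
    and ord: "two_line_ordered (w @ [(i, j)])"
    and cnt: "\<And>i' j'. j' \<in> B1 n \<Longrightarrow> count_list (w @ [(i, j)]) (i', j') \<le> 1"
    using assms unfolding two_line_arrays_def by simp_all
  have "count_list w (i', j') \<le> 1" if "j' \<in> B1 n" for i' j'
    using cnt[OF that, of i'] by (simp split: if_splits)
  then show "w \<in> two_line_arrays m n q"
    using set(1) ord by (simp add: two_line_arrays_def two_line_ordered_snoc)
  show "i \<in> {1..q}" using set(2) by blast
  have j: "j \<in> B0 m \<union> B1 n" using set(2) by blast
  then show "j \<in> spo_row m n 0" by (auto simp: spo_row_def B0_def B1_def less_eq_letter_def)
  assume w: "w \<noteq> []"
  have "in_B0 j" if eq: "last w = (i, j)"
  proof (rule ccontr)
    assume "\<not> in_B0 j"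
    then have "j \<in> B1 n" using j by (auto simp: B0_def)
    moreover obtain u where "w = u @ [(i, j)]" using append_butlast_last_id[OF w] eq by metis
    then have "2 \<le> count_list (w @ [(i, j)]) (i, j)" by simp
    moreover from \<open>j \<in> B1 n\<close> have "count_list (w @ [(i, j)]) (i, j) \<le> 1" by (rule cnt)
    ultimately show False by linarith
  qed
  moreover have "fst (last w) \<le> i" "fst (last w) = i \<Longrightarrow> snd (last w) \<le> j"
    using ord w by (simp_all add: two_line_ordered_snoc)
  ultimately show "fst (last w) < i \<or> fst (last w) = i \<and> rle (snd (last w)) j"
    using prod_eqI[of "last w" "(i, j)"] by (auto simp: rle_def order_le_less)
qed

lemma spo_correspondence_done:
  assumes "w \<in> two_line_arrays m n q" "w \<noteq> []" "spo_correspondence w = (Pt, P, L)"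
  shows "spo_done m n q (fst (last w)) (snd (last w)) Pt P L"
  using assms
proof (induction w arbitrary: Pt P L rule: rev_induct)
  case Nil
  then show ?case by simp
next
  case (snoc x w)
  obtain i j where x: "x = (i, j)" by fastforce
  note w = two_line_arrays_snoc[OF snoc.prems(1)[unfolded x]]
  obtain Pt0 P0 L0 where st: "spo_correspondence w = (Pt0, P0, L0)" by (metis surj_pair)
  have step: "spo_step (Pt0, P0, L0) (i, j) = (Pt, P, L)"
    using snoc.prems(3) st by (simp add: spo_correspondence_def x)
  have "spo_ready m n q i j Pt0 P0 L0 \<and> (L0 \<noteq> [] \<longrightarrow> fst (last L0) \<le> i)"
  proof (cases "w = []")
    case True
    then have *: "Pt0 = []" "P0 = []" "L0 = []" using st by (simp_all add: spo_correspondence_def)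
    \<comment> \<open>The first column adds a box to the empty tableau, so the condition on older
      \<open>i\<close> in \<open>P\<close> is vacuous.\<close>
    have "spo_insert [] j = (add_box [] 0 j, Added 0)"
      unfolding spo_insert_def by (subst insert_from.simps) simp
    then show ?thesis
      using w(2,3) by (auto simp: * spo_ready_def tab_empty burge_array_def two_line_ordered_def rlen_def)
  next
    case False
    note IH = snoc.IH[OF w(1) False st]
    have "spo_ready m n q i j Pt0 P0 L0"
      using IH w(4)[OF False] w(2,3) by (rule spo_done_ready)
    moreover have "fst (last L0) \<le> i" if "L0 \<noteq> []"
      using IH w(4)[OF False] that by (auto simp: spo_done_def)
    ultimately show ?thesis by blast
  qed
  then show ?case using spo_step_done[OF _ step] by (simp add: x)
qed

theorem theorem4p4:
  fixes m n q :: nat and \<pi> :: "(nat \<times> letter) list"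
    and Pt :: "letter tableau" and P :: "nat tableau" and L :: "(nat \<times> nat) list"
  assumes "1 \<le> m" and "1 \<le> n" and "1 \<le> q"
    and "\<pi> \<in> two_line_arrays m n q"
    and "spo_correspondence \<pi> = (Pt, P, L)"
  shows "(\<exists>lam. spo_tableau m n lam Pt \<and> semistandard lam P \<and> entries P \<subseteq> {1..q}) \<and>
         burge_array q L"
proof -
  have "tab rle (spo_row m n) {} Pt \<and> tab (\<le>) (\<lambda>_. {1..q}) {} P \<and> rlen P = rlen Pt \<and> burge_array q L"
  \<comment> \<open>\<open>spo_done\<close> refers to the last column processed, so the empty array
    is treated apart.\<close>
  proof (cases "\<pi> = []")
    case True
    then have "Pt = []" "P = []" "L = []" using assms(5) by (simp_all add: spo_correspondence_def)
    then show ?thesis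
      by (simp add: tab_empty burge_array_def two_line_ordered_def rlen_def fun_eq_iff)
  next
    case False
    note D = spo_correspondence_done[OF assms(4) False assms(5)]
    then have "tab (\<le>) (\<lambda>_. {1..fst (last \<pi>)}) {} P" "fst (last \<pi>) \<le> q" by (simp_all add: spo_done_def)
    then have "tab (\<le>) (\<lambda>_. {1..q}) {} P" by (elim tab_mono) auto
    then show ?thesis using D by (simp add: spo_done_def)
  qed
  then have Pt: "tab rle (spo_row m n) {} Pt" and P: "tab (\<le>) (\<lambda>_. {1..q}) {} P"
    and len: "rlen P = rlen Pt" and L: "burge_array q L" by simp_all
  \<comment> \<open>Neither tableau has empty rows, so equal row lengths force equally many
    rows.\<close>
  have "length P = length Pt"
    using tab_length_iff[OF P] tab_length_iff[OF Pt] by (metis len linorder_neq_iff)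
  moreover from this have "length (P ! r) = length (Pt ! r)" if "r < length P" for r
    using fun_cong[OF len, of r] that by (simp add: rlen_def)
  ultimately have "shape P = shape Pt"
    unfolding shape_def by (intro nth_equalityI) simp_all
  then have "semistandard (shape Pt) P" using tab_semistandard[OF P] by simp
  moreover have "entries P \<subseteq> {1..q}" using P by (rule tab_entries) simp
  ultimately show ?thesis using tab_spo_tableau[OF Pt] L by blast
qed

end
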